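(* Let $X=(X_1,X_2,\dots)$ be a sequence of square integrable, nonnegative random variables, independent of all else (in particular of the random variables $N$ and $M$ below), such that, for all $i\ge1$, $$\mathbb{E}(X_i\mid X_1,\dots,X_{i-1})=\mu_i<\infty\quad\text{almost surely},$$ where $\mu_i$ is a constant. Let $N$ be a positive, integer valued random variable with $\mathbb{E}N<\infty$ and let $M$ be a random variable satisfying $$\mathbb{P}(M=m)=\mu_m\mathbb{P}(N\ge m)/\mu,\qquad m=1,2,\dots,$$ with $$\mu=\mathbb{E}\sum_{i=1}^N X_i=\sum_{m\ge1}\mu_m\mathbb{P}(N\ge m).$$ Then, with $W=\mu^{-1}\sum_{i=1}^N X_i$, we have $$d_{\mathrm W}(\mathcal L(W),\mathrm{Exp}(1))\le 2\mu^{-1}\Bigl(\mathbb{E}|X_M-X_M^e|+\sup_{i\ge1}\mu_i\;\mathbb{E}|N-M|\Bigr),$$ where each $X_i^e$ is a random variable having the equilibrium distribution with respect to $X_i$ given $X_1,\dots,X_{i-1}$. If, in addition, $X_i\le C$ for all $i$ and $|N-M|\le K$, then $$d_{\mathrm K}(\mathcal L(W),\mathrm{Exp}(1))\le 12\mu^{-1}\Bigl\{\sup_{i\ge1}\|F_{X_i}^{-1}-F_{X_i^e}^{-1}\|+CK\Bigr\};$$ if $K=0$, the same bound also holds for unbounded $X_i$.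
   Context: $\mathcal{L}(X)$ denotes the law of $X$; $\mathrm{Exp}(1)$ is the exponential distribution with mean $1$. The Kolmogorov distance is $d_{\mathrm K}(P,Q)=\sup_{z}|P((-\infty,z])-Q((-\infty,z])|$; the Wasserstein distance is $d_{\mathrm W}(P,Q)=\sup_h|\int h\,dP-\int h\,dQ|$ over all $h:\mathbb{R}\to\mathbb{R}$ with Lipschitz constant at most $1$. Equilibrium distribution: for a nonnegative random variable $Y$ with finite mean, a random variable $Y^e$ has the equilibrium distribution with respect to $Y$ if $\mathbb{E}f(Y)-f(0)=\mathbb{E}Y\;\mathbb{E}f'(Y^e)$ for all Lipschitz $f$; this implies $\mathbb{P}(Y^e\le x)=\frac1{\mathbb{E}Y}\int_0^x\mathbb{P}[Y>y]\,dy$. For a random variable $Y$, $F_Y$ denotes its distribution function and $F_Y^{-1}$ the generalized inverse of $F_Y$; $\|\cdot\|$ is the supremum norm.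
   Formalization: In the Kolmogorov bound, the distribution functions of X_i and X_i^e are taken conditionally on X_1,…,X_{i-1}, with an essential supremum over the conditioning (the marginal version fails for dependent X_i); the pairs (X_i, X_i^e) are taken to be independent of (N, M). *)

theory Defs
  imports "HOL-Probability.Probability"
begin

definition kolmogorov_dist :: "real measure \<Rightarrow> real measure \<Rightarrow> ennreal" where
  "kolmogorov_dist P Q = (SUP z. ennreal \<bar>cdf P z - cdf Q z\<bar>)"

(* Meant for laws with finite mean, for which every Lipschitz function is integrable. *)
definition wasserstein_dist :: "real measure \<Rightarrow> real measure \<Rightarrow> ennreal" where
  "wasserstein_dist P Q =
     (SUP h\<in>{h :: real \<Rightarrow> real. 1-lipschitz_on UNIV h}.
        ennreal \<bar>integral\<^sup>L P h - integral\<^sup>L Q h\<bar>)"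

definition exp1 :: "real measure" where
  "exp1 = density lborel (\<lambda>x. ennreal (exponential_density 1 x))"

(* Q is the law of Y and Qe the law of Y^e.  A Lipschitz f may fail to be differentiable on a
   Lebesgue null set, where deriv f takes an unspecified constant value.  If Y has positive mean,
   the C^1 functions f already force Qe to have the density P(Y > y) / E Y on the positive
   half-line, so that such null sets are irrelevant.  If E Y = 0 the identity holds for every Qe. *)
definition equilibrium_law :: "real measure \<Rightarrow> real measure \<Rightarrow> bool" where
  "equilibrium_law Q Qe \<longleftrightarrow>
     (\<forall>f :: real \<Rightarrow> real. (\<exists>L. L-lipschitz_on UNIV f) \<longrightarrow>
        (\<integral>y. f y \<partial>Q) - f 0 = (\<integral>y. y \<partial>Q) * (\<integral>y. deriv f y \<partial>Qe))"

(* The sigma-algebra generated by X 1, ..., X (i - 1); trivial for i = 1. *)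
definition past :: "'a measure \<Rightarrow> (nat \<Rightarrow> 'a \<Rightarrow> real) \<Rightarrow> nat \<Rightarrow> 'a measure" where
  "past P X i =
     vimage_algebra (space P) (\<lambda>\<omega>. \<lambda>j\<in>{1..<i}. X j \<omega>) (\<Pi>\<^sub>M j\<in>{1..<i}. borel)"

definition regular_cond_law ::
    "'a measure \<Rightarrow> 'a measure \<Rightarrow> ('a \<Rightarrow> real) \<Rightarrow> ('a \<Rightarrow> real measure) \<Rightarrow> bool" where
  "regular_cond_law P F Y \<kappa> \<longleftrightarrow>
     \<kappa> \<in> F \<rightarrow>\<^sub>M prob_algebra borel \<and>
     (\<forall>A\<in>sets borel. AE \<omega> in P.
        measure (\<kappa> \<omega>) A = real_cond_exp P F (\<lambda>\<omega>'. indicator A (Y \<omega>')) \<omega>)"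

definition gen_inverse :: "(real \<Rightarrow> real) \<Rightarrow> real \<Rightarrow> real" where
  "gen_inverse F u = Inf {x. u \<le> F x}"

definition quantile_sup_dist :: "real measure \<Rightarrow> real measure \<Rightarrow> ennreal" where
  "quantile_sup_dist Q R =
     (SUP u\<in>{0<..<1}. ennreal \<bar>gen_inverse (cdf Q) u - gen_inverse (cdf R) u\<bar>)"

end

theory Submission
  imports Defs
begin

text \<open>
  Write \<open>S n = X 1 + \<dots> + X n\<close> and \<open>W = S N / \<mu>\<close>. Telescoping \<open>g (S N) - g 0\<close>, conditioning each increment
  on the past and using that \<open>N\<close> and \<open>M\<close> are independent of the summands shows that
  \<open>We = (S (M - 1) + Xe M) / \<mu>\<close> has the equilibrium distribution of \<open>W\<close>. It is close to \<open>W\<close>, because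
  \<open>\<mu> (W - We) = (X M - Xe M) + (S N - S M)\<close>.

  For the Wasserstein distance, Stein's equation \<open>f' - f = h - E h(Z)\<close> with \<open>Z \<sim> Exp(1)\<close> turns
  \<open>E h(W) - E h(Z)\<close> into \<open>E f'(W) - E f'(We)\<close>, where \<open>f'\<close> is \<open>2\<close>-Lipschitz.
  For the Kolmogorov distance, the tails of \<open>W\<close> and \<open>We\<close> dominate each other up to a shift \<open>b\<close>. Since
  \<open>H x = P(We > x)\<close> is the integrated tail of \<open>W\<close>, this is an approximate differential equation
  \<open>H' = - H\<close>, and a Gronwall argument gives the distance bound \<open>2 b\<close>, which is better than the
  constant \<open>12\<close> requires.
\<close>

section \<open>Exponential approximation by equilibrium couplings\<close>

text \<open>The equilibrium identity is only ever applied to everywhere differentiable functions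
  with continuous bounded derivative. There \<open>deriv\<close> has its true value, so exceptional
  null sets of Lipschitz functions never appear. Stein solutions lie in this class; indicators do
  not, and tails are therefore reached as limits of ramps. Conditioning and summation over the
  random index are done with nonnegative integrals of increments of nondecreasing functions, so that
  sums and integrals may be interchanged freely. Because \<open>mu m\<close> is constant, it leaves
  the conditional expectation, and \<open>\<mu> * P(M = m) = mu m * P(N \<ge> m)\<close> turns the
  weights of the telescoped sum into those of a mixture over \<open>M\<close>. The two distances
  exploit the coupling differently. The Wasserstein bound uses the pathwise difference of
  \<open>X M\<close> and \<open>Xe M\<close>. The quantile distance speaks of conditional laws
  alone, so the Kolmogorov bound compares the tails of two mixtures that have the same
  weights.\<close>

lemma prob_space_exp1: "prob_space exp1"
  unfolding exp1_def by (rule prob_space_exponential_density) simp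

lemma sets_exp1 [measurable_cong, simp]: "sets exp1 = sets borel"
  by (simp add: exp1_def)

lemma space_exp1 [simp]: "space exp1 = UNIV"
  by (simp add: exp1_def)

lemma distributed_exp1: "distributed exp1 lborel (\<lambda>x. x) (exponential_density 1)"
  unfolding distributed_def
proof (intro conjI)
  show "distr exp1 lborel (\<lambda>x. x) = density lborel (\<lambda>x. ennreal (exponential_density 1 x))"
    unfolding exp1_def by (rule distr_id2) simp
qed auto

lemma cdf_exp1: "cdf exp1 z = (if z < 0 then 0 else 1 - exp (- z))"
proof -
  interpret prob_space exp1 by (rule prob_space_exp1)
  have *: "cdf exp1 z = 1 - exp (- z)" if "0 \<le> z" for z
    using exponential_distributedD_le[OF distributed_exp1 that] by (simp add: cdf_def atMost_def)
  have "cdf exp1 z \<le> cdf exp1 0" if "z < 0"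
    unfolding cdf_def using that by (intro finite_measure_mono) auto
  then show ?thesis
    using * by (auto simp: cdf_def intro: antisym)
qed

lemma integrable_id_exp1: "integrable exp1 (\<lambda>x. x)"
proof -
  interpret prob_space exp1 by (rule prob_space_exp1)
  have "expectation (\<lambda>x. x) = 1"
    using exponential_distributed_expectation[OF _ distributed_exp1] by simp
  \<comment> \<open>A non-integrable function has Bochner integral 0 by convention, so the value 1
    already forces integrability.\<close>
  then show ?thesis
    using not_integrable_integral_eq by fastforce
qed

section \<open>Lipschitz test functions and Stein's equation\<close>

lemma borel_measurable_lipschitz [measurable_dest]:
  fixes h :: "real \<Rightarrow> real"
  shows "L-lipschitz_on UNIV h \<Longrightarrow> h \<in> borel_measurable borel"
  by (intro borel_measurable_continuous_onI lipschitz_on_continuous_on)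

lemma (in prob_space) integrable_lipschitz:
  fixes h :: "real \<Rightarrow> real"
  assumes h: "L-lipschitz_on UNIV h" and Y: "integrable M Y"
  shows "integrable M (\<lambda>\<omega>. h (Y \<omega>))"
proof (rule Bochner_Integration.integrable_bound)
  show "integrable M (\<lambda>\<omega>. \<bar>h 0\<bar> + L * \<bar>Y \<omega>\<bar>)"
    using Y by auto
  have [measurable]: "h \<in> borel_measurable borel" "Y \<in> borel_measurable M"
    using h Y by auto
  show "(\<lambda>\<omega>. h (Y \<omega>)) \<in> borel_measurable M" by measurable
  have "\<bar>h y\<bar> \<le> \<bar>h 0\<bar> + L * \<bar>y\<bar>" for y
    using lipschitz_onD[OF h, of y 0] by (simp add: dist_real_def)
  then show "AE \<omega> in M. norm (h (Y \<omega>)) \<le> norm (\<bar>h 0\<bar> + L * \<bar>Y \<omega>\<bar>)"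
    by (intro AE_I2) (smt (verit) real_norm_def)
qed

text \<open>A difference of two tail integrals is an integral over a compact interval, hence a
  difference of values of an antiderivative \<open>F\<close> of \<open>k\<close>. So the tail
  integral is a constant minus \<open>F\<close>.\<close>

lemma has_real_derivative_tail_integral:
  fixes k :: "real \<Rightarrow> real"
  assumes cont: "continuous_on UNIV k"
    and int: "\<And>x. integrable lborel (\<lambda>z. indicator {x..} z * k z)"
  shows "((\<lambda>x. \<integral>z. indicator {x..} z * k z \<partial>lborel) has_real_derivative - k x) (at x)"
proof -
  define v where "v x = (\<integral>z. indicator {x..} z * k z \<partial>lborel)" for x
  have "\<exists>F. \<forall>x::real. -\<infinity> < ereal x \<longrightarrow> ereal x < \<infinity> \<longrightarrow> (F has_vector_derivative k x) (at x)"
    using cont by (intro einterval_antiderivative) (auto simp: continuous_on_eq_continuous_at)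
  then obtain F where F: "(F has_real_derivative k x) (at x)" for x
    by (auto simp: has_real_derivative_iff_has_vector_derivative)
  have *: "v x - v y = F y - F x" if "x \<le> y" for x y
  proof -
    have "v x - v y = (\<integral>z. indicator {x..} z * k z - indicator {y..} z * k z \<partial>lborel)"
      unfolding v_def by (rule Bochner_Integration.integral_diff[symmetric]) (rule int)+
    also have "\<dots> = (\<integral>z. k z * indicator {x..y} z \<partial>lborel)"
    proof (rule integral_cong_AE)
      have [measurable]: "k \<in> borel_measurable borel"
        using cont by (rule borel_measurable_continuous_onI)
      show "(\<lambda>z. indicator {x..} z * k z - indicator {y..} z * k z) \<in> borel_measurable lborel"
        "(\<lambda>z. k z * indicator {x..y} z) \<in> borel_measurable lborel"
        by measurable
      \<comment> \<open>The difference of the indicators is that of a half-open interval; it misses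
        the endpoint \<open>y\<close>, a null set.\<close>
      show "AE z in lborel. indicator {x..} z * k z - indicator {y..} z * k z = k z * indicator {x..y} z"
        using AE_lborel_singleton[of y] by eventually_elim (use that in \<open>auto split: split_indicator\<close>)
    qed
    also have "\<dots> = F y - F x"
      using that cont
      by (intro integral_FTC_Icc_real F) (auto simp: continuous_on_eq_continuous_at)
    finally show ?thesis .
  qed
  have "v x = v 0 + F 0 - F x" for x
    using *[of 0 x] *[of x 0] by (cases "0 \<le> x") auto
  then have v_eq: "v = (\<lambda>x. v 0 + F 0 - F x)" by (rule ext)
  have "(v has_real_derivative - k x) (at x)"
    by (subst v_eq) (auto intro!: derivative_eq_intros F)
  then show ?thesis unfolding v_def .
qed

text \<open>The Stein equation \<open>f' - f = h - E h(Z)\<close> for \<open>Z \<sim> Exp(1)\<close> is solved by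
  \<open>f x = E h(Z) - E h(x + Z)\<close>, which makes the Lipschitz bounds evident.\<close>

lemma stein_equation_exp1:
  fixes h :: "real \<Rightarrow> real"
  assumes h: "1-lipschitz_on UNIV h"
  obtains f f' :: "real \<Rightarrow> real" where "f 0 = 0" "1-lipschitz_on UNIV f" "2-lipschitz_on UNIV f'"
    "\<And>x. (f has_real_derivative f' x) (at x)" "\<And>x. f' x - f x = h x - integral\<^sup>L exp1 h"
proof -
  interpret prob_space exp1 by (rule prob_space_exp1)
  have hm [measurable]: "h \<in> borel_measurable borel" using h by auto
  have hc: "continuous_on UNIV h" using h by (rule lipschitz_on_continuous_on)
  define u where "u x = (\<integral>t. h (x + t) \<partial>exp1)" for x
  have int: "integrable exp1 (\<lambda>t. h (x + t))" for x
    by (rule integrable_lipschitz[OF h]) (auto intro: integrable_id_exp1)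
  have dens: "exponential_density 1 (z - x) = exp x * (indicator {x..} z * exp (- z))" for x z :: real
    by (auto simp: exponential_density_def mult_exp_exp split: split_indicator)
  \<comment> \<open>The substitution z = x + t moves \<open>x\<close> out of the argument of
    \<open>h\<close> into the factor \<open>exp x\<close> and the limit of integration. Thus
    \<open>u\<close> is differentiable although \<open>h\<close> is merely Lipschitz, and the
    product rule gives u' = u - h.\<close>
  have int': "integrable lborel (\<lambda>z. exp x * (indicator {x..} z * (exp (- z) * h z)))"
    and u_eq: "u x = exp x * (\<integral>z. indicator {x..} z * (exp (- z) * h z) \<partial>lborel)" for x
  proof -
    have eq: "exp x * (indicator {x..} z * (exp (- z) * h z)) = exponential_density 1 (z - x) * h z" for z
      unfolding dens by (simp add: mult_ac)
    have "integrable lborel (\<lambda>t. exponential_density 1 t * h (x + t))"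
      using int[of x] unfolding exp1_def by (subst (asm) integrable_density) (auto simp: exponential_density_nonneg)
    then have "integrable lborel (\<lambda>z. exponential_density 1 (- x + z) * h (x + (- x + z)))"
      by (drule_tac lborel_integrable_real_affine[where c=1 and t="- x"]) simp_all
    then show "integrable lborel (\<lambda>z. exp x * (indicator {x..} z * (exp (- z) * h z)))"
      unfolding eq by (simp add: algebra_simps)
    have "u x = (\<integral>t. exponential_density 1 t * h (x + t) \<partial>lborel)"
      unfolding u_def exp1_def by (subst integral_density) (auto simp: exponential_density_nonneg)
    also have "\<dots> = (\<integral>z. exponential_density 1 (- x + z) * h (x + (- x + z)) \<partial>lborel)"
      by (subst lborel_integral_real_affine[of 1 _ "- x"]) auto
    also have "\<dots> = (\<integral>z. exp x * (indicator {x..} z * (exp (- z) * h z)) \<partial>lborel)"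
      unfolding eq by (simp add: algebra_simps)
    finally show "u x = exp x * (\<integral>z. indicator {x..} z * (exp (- z) * h z) \<partial>lborel)" by simp
  qed
  have u_deriv: "(u has_real_derivative u x - h x) (at x)" for x
  proof -
    have "((\<lambda>x. \<integral>z. indicator {x..} z * (exp (- z) * h z) \<partial>lborel)
        has_real_derivative - (exp (- x) * h x)) (at x)"
    proof (rule has_real_derivative_tail_integral)
      show "continuous_on UNIV (\<lambda>z. exp (- z) * h z)"
        by (intro continuous_intros hc)
      show "integrable lborel (\<lambda>z. indicator {x..} z * (exp (- z) * h z))" for x
        using int'[of x] by simp
    qed
    note D = DERIV_mult[OF DERIV_exp this]
    show ?thesis
      unfolding u_eq by (rule DERIV_cong[OF D]) (simp add: exp_minus mult.commute)
  qed
  have u_lip: "1-lipschitz_on UNIV u"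
  proof (rule lipschitz_onI)
    fix x y :: real
    have "\<bar>u x - u y\<bar> = \<bar>\<integral>t. h (x + t) - h (y + t) \<partial>exp1\<bar>"
      unfolding u_def using int by (subst Bochner_Integration.integral_diff) auto
    also have "\<dots> \<le> (\<integral>t. \<bar>x - y\<bar> \<partial>exp1)"
    proof (intro order_trans[OF integral_abs_bound] integral_mono Bochner_Integration.integrable_diff int
            integrable_abs)
      show "\<bar>h (x + t) - h (y + t)\<bar> \<le> \<bar>x - y\<bar>" for t
        using lipschitz_onD[OF h, of "x + t" "y + t"] by (simp add: dist_real_def)
    qed simp_all
    also have "\<dots> = \<bar>x - y\<bar>" using prob_space by simp
    finally show "dist (u x) (u y) \<le> 1 * dist x y" by (simp add: dist_real_def)
  qed simp
  define f where "f x = u 0 - u x" for x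
  have u0: "u 0 = integral\<^sup>L exp1 h" by (simp add: u_def)
  show ?thesis
  proof (rule that)
    show "f 0 = 0" by (simp add: f_def)
    show "1-lipschitz_on UNIV f"
      unfolding f_def using u_lip by (auto simp: lipschitz_on_def dist_real_def abs_minus_commute)
    show "(f has_real_derivative h x - u x) (at x)" for x
      unfolding f_def using u_deriv by (auto intro!: derivative_eq_intros)
    show "(h x - u x) - f x = h x - integral\<^sup>L exp1 h" for x by (simp add: f_def u0)
    \<comment> \<open>The constant 2 comes from \<open>h\<close> and \<open>u\<close>, each of which
      is 1-Lipschitz.\<close>
    show "2-lipschitz_on UNIV (\<lambda>x. h x - u x)"
      using lipschitz_on_diff[OF h u_lip] by simp
  qed
qed

section \<open>The Wasserstein distance to the exponential law\<close>

text \<open>Both L y - f y and L y + f y are nondecreasing, so their derivatives L - D and L + D are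
  nonnegative.\<close>

lemma deriv_bound_of_lipschitz:
  fixes f :: "real \<Rightarrow> real"
  assumes f: "L-lipschitz_on UNIV f" and D: "(f has_real_derivative D) (at x)"
  shows "\<bar>D\<bar> \<le> L"
proof -
  have *: "\<bar>f x - f y\<bar> \<le> L * \<bar>x - y\<bar>" for x y
    using lipschitz_onD[OF f, of x y] by (simp add: dist_real_def)
  have "L - D \<ge> 0"
  proof (rule mono_on_imp_deriv_nonneg)
    show "mono_on UNIV (\<lambda>y. L * y - f y)"
    proof (rule mono_onI)
      fix r s :: real assume "r \<le> s" then show "L * r - f r \<le> L * s - f s"
        using *[of s r] by (simp add: algebra_simps abs_le_iff)
    qed
    show "((\<lambda>y. L * y - f y) has_real_derivative L - D) (at x)"
      by (auto intro!: derivative_eq_intros D)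
  qed auto
  moreover have "L + D \<ge> 0"
  proof (rule mono_on_imp_deriv_nonneg)
    show "mono_on UNIV (\<lambda>y. L * y + f y)"
    proof (rule mono_onI)
      fix r s :: real assume "r \<le> s" then show "L * r + f r \<le> L * s + f s"
        using *[of s r] by (simp add: algebra_simps abs_le_iff)
    qed
    show "((\<lambda>y. L * y + f y) has_real_derivative L + D) (at x)"
      by (auto intro!: derivative_eq_intros D)
  qed auto
  ultimately show ?thesis by auto
qed

text \<open>The class of test functions in \<open>equil\<close> is the one that contains Stein
  solutions of 1-Lipschitz \<open>h\<close>. The bound on f' makes f'(We) integrable whatever the
  moments of \<open>We\<close>, and the identity function as test function shows that
  \<open>equil\<close> encodes E W = 1. The right-hand side may be infinite.\<close>

lemma (in prob_space) wasserstein_exp1_le: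
  fixes W We :: "'a \<Rightarrow> real"
  assumes W: "integrable M W" and We [measurable]: "We \<in> borel_measurable M"
    and equil: "\<And>f f' :: real \<Rightarrow> real. \<lbrakk>\<And>x. (f has_real_derivative f' x) (at x); continuous_on UNIV f';
        \<And>x. \<bar>f' x\<bar> \<le> 1\<rbrakk> \<Longrightarrow> expectation (\<lambda>\<omega>. f (W \<omega>)) - f 0 = expectation (\<lambda>\<omega>. f' (We \<omega>))"
  shows "wasserstein_dist (distr M borel W) exp1 \<le> 2 * (\<integral>\<^sup>+\<omega>. ennreal \<bar>W \<omega> - We \<omega>\<bar> \<partial>M)"
  unfolding wasserstein_dist_def
proof (rule SUP_least, clarify)
  fix h :: "real \<Rightarrow> real" assume h: "1-lipschitz_on UNIV h"
  have [measurable]: "W \<in> borel_measurable M" "h \<in> borel_measurable borel" using W h by auto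
  obtain f f' where f: "f 0 = 0" "1-lipschitz_on UNIV f" "2-lipschitz_on UNIV f'"
    "\<And>x. (f has_real_derivative f' x) (at x)" "\<And>x. f' x - f x = h x - integral\<^sup>L exp1 h"
    using stein_equation_exp1[OF h] by blast
  have [measurable]: "f' \<in> borel_measurable borel" using f(3) by auto
  have bd: "\<bar>f' x\<bar> \<le> 1" for x using deriv_bound_of_lipschitz[OF f(2,4)] .
  have int': "integrable M (\<lambda>\<omega>. f' (W \<omega>))" "integrable M (\<lambda>\<omega>. f' (We \<omega>))"
    using bd by (auto intro!: integrable_const_bound[where B=1])
  have int: "integrable M (\<lambda>\<omega>. f (W \<omega>))" "integrable M (\<lambda>\<omega>. h (W \<omega>))"
    using integrable_lipschitz[OF f(2) W] integrable_lipschitz[OF h W] by auto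
  have "integral\<^sup>L (distr M borel W) h - integral\<^sup>L exp1 h
      = expectation (\<lambda>\<omega>. h (W \<omega>) - integral\<^sup>L exp1 h)"
    using int by (simp add: integral_distr prob_space)
  also have "\<dots> = expectation (\<lambda>\<omega>. f' (W \<omega>) - f (W \<omega>))"
    by (simp add: f(5))
  also have "\<dots> = expectation (\<lambda>\<omega>. f' (W \<omega>)) - expectation (\<lambda>\<omega>. f (W \<omega>))"
    using int int' by simp
  also have "expectation (\<lambda>\<omega>. f (W \<omega>)) = expectation (\<lambda>\<omega>. f' (We \<omega>))"
    using equil[OF f(4) _ bd] f(1) lipschitz_on_continuous_on[OF f(3)] by simp
  also have "expectation (\<lambda>\<omega>. f' (W \<omega>)) - \<dots> = expectation (\<lambda>\<omega>. f' (W \<omega>) - f' (We \<omega>))"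
    using int' by simp
  finally have "ennreal \<bar>integral\<^sup>L (distr M borel W) h - integral\<^sup>L exp1 h\<bar>
      = ennreal (norm (expectation (\<lambda>\<omega>. f' (W \<omega>) - f' (We \<omega>))))" by simp
  also have "\<dots> \<le> (\<integral>\<^sup>+\<omega>. norm (f' (W \<omega>) - f' (We \<omega>)) \<partial>M)"
    using int' by (intro integral_norm_bound_ennreal) auto
  also have "\<dots> \<le> (\<integral>\<^sup>+\<omega>. 2 * ennreal \<bar>W \<omega> - We \<omega>\<bar> \<partial>M)"
  proof (rule nn_integral_mono)
    fix \<omega>
    have "norm (f' (W \<omega>) - f' (We \<omega>)) \<le> 2 * \<bar>W \<omega> - We \<omega>\<bar>"
      using lipschitz_onD[OF f(3), of "W \<omega>" "We \<omega>"] by (simp add: dist_real_def)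
    then show "ennreal (norm (f' (W \<omega>) - f' (We \<omega>))) \<le> 2 * ennreal \<bar>W \<omega> - We \<omega>\<bar>"
      by (metis ennreal_leI ennreal_mult'' ennreal_numeral abs_ge_zero)
  qed
  also have "\<dots> = 2 * (\<integral>\<^sup>+\<omega>. ennreal \<bar>W \<omega> - We \<omega>\<bar> \<partial>M)"
    by (rule nn_integral_cmult) measurable
  finally show "ennreal \<bar>integral\<^sup>L (distr M borel W) h - integral\<^sup>L exp1 h\<bar>
      \<le> 2 * (\<integral>\<^sup>+\<omega>. ennreal \<bar>W \<omega> - We \<omega>\<bar> \<partial>M)" .
qed

section \<open>The Kolmogorov distance to the exponential law\<close>

text \<open>Differences of such squares are continuously differentiable functions whose derivatives
  are ramps; they serve as smooth substitutes for (y - x)^+.\<close>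

lemma has_real_derivative_pos_part_square:
  fixes a y :: real
  shows "((\<lambda>y. (max 0 (y - a))\<^sup>2) has_real_derivative 2 * max 0 (y - a)) (at y)"
proof -
  consider "y < a" | "y > a" | "y = a" by linarith
  then show ?thesis
  proof cases
    case 1
    have "((\<lambda>y. (max 0 (y - a))\<^sup>2) has_real_derivative 0) (at y)"
      by (rule has_field_derivative_transform_within_open[of "\<lambda>_. 0" _ _ "{..<a}"]) (use 1 in auto)
    then show ?thesis using 1 by simp
  next
    case 2
    have "((\<lambda>y. (max 0 (y - a))\<^sup>2) has_real_derivative 2 * (y - a)) (at y)"
      by (rule has_field_derivative_transform_within_open[of "\<lambda>y. (y - a)\<^sup>2" _ _ "{a<..}"])
        (use 2 in \<open>auto intro!: derivative_eq_intros\<close>)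
    then show ?thesis using 2 by simp
  next
    case 3
    have "((\<lambda>h. (max 0 h)\<^sup>2 / h) \<longlongrightarrow> 0) (at (0::real))"
    proof (rule Lim_null_comparison)
      show "\<forall>\<^sub>F h in at 0. norm ((max 0 h)\<^sup>2 / h) \<le> \<bar>h\<bar>"
        by (rule always_eventually) (auto simp: max_def power2_eq_square)
      show "((\<lambda>h::real. \<bar>h\<bar>) \<longlongrightarrow> 0) (at 0)" by (auto intro!: tendsto_eq_intros)
    qed
    then show ?thesis using 3 by (simp add: DERIV_def)
  qed
qed

text \<open>Formally this is the equilibrium identity for f y = (y - x)^+, whose derivative is the
  indicator of y > x. Since that derivative jumps, it is replaced by a ramp rising from 0 at
  \<open>x\<close> to 1 at \<open>x + d n\<close>, and dominated convergence removes the ramp. The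
  ramp starts at \<open>x\<close>, so the limit is the strict tail.\<close>

lemma (in prob_space) equilibrium_tail:
  fixes W We :: "'a \<Rightarrow> real"
  assumes W: "integrable M W" and We [measurable]: "We \<in> borel_measurable M"
    and equil: "\<And>f f' :: real \<Rightarrow> real. \<lbrakk>\<And>x. (f has_real_derivative f' x) (at x); continuous_on UNIV f';
        \<And>x. \<bar>f' x\<bar> \<le> 1\<rbrakk> \<Longrightarrow> expectation (\<lambda>\<omega>. f (W \<omega>)) - f 0 = expectation (\<lambda>\<omega>. f' (We \<omega>))"
    and x: "0 \<le> x"
  shows "prob {\<omega> \<in> space M. x < We \<omega>} = expectation (\<lambda>\<omega>. max 0 (W \<omega> - x))"
proof -
  have [measurable]: "W \<in> borel_measurable M" using W by auto
  define d :: "nat \<Rightarrow> real" where "d n = inverse (real (Suc n))" for n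
  have d0: "d n > 0" for n by (simp add: d_def)
  have dlim: "d \<longlonglongrightarrow> 0" unfolding d_def by (rule LIMSEQ_inverse_real_of_nat)
  define f where "f n y = ((max 0 (y - x))\<^sup>2 - (max 0 (y - (x + d n)))\<^sup>2) / (2 * d n)" for n y
  define f' where "f' n y = (max 0 (y - x) - max 0 (y - (x + d n))) / d n" for n y
  have f_deriv: "(f n has_real_derivative f' n y) (at y)" for n y
    unfolding f_def f'_def
    by (rule DERIV_cong[OF DERIV_cdivide[OF DERIV_diff[OF has_real_derivative_pos_part_square
          has_real_derivative_pos_part_square]]]) (use d0[of n] in \<open>simp add: field_simps\<close>)
  have f'_cont: "continuous_on UNIV (f' n)" for n
    unfolding f'_def by (intro continuous_intros) (use d0[of n] in auto)
  have f'_bd: "0 \<le> f' n y" "f' n y \<le> 1" for n y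
    using d0[of n] by (auto simp: f'_def field_simps)
  \<comment> \<open>This is where x \<ge> 0 enters: 0 lies to the left of the ramp.\<close>
  have f_0: "f n 0 = 0" for n using x d0[of n] by (simp add: f_def max_def)
  have f_bd: "\<bar>f n y\<bar> \<le> max 0 (y - x)" and f_close: "\<bar>f n y - max 0 (y - x)\<bar> \<le> d n" for n y
  proof -
    define p where "p = max 0 (y - x)"
    define r where "r = max 0 (y - (x + d n))"
    \<comment> \<open>Left of the end of the ramp r = 0 and p \<le> d n; right of it p - r is
      exactly \<open>d n\<close> and \<open>f n y\<close> equals p - d n / 2.\<close>
    have pr: "0 \<le> p" "0 \<le> r" "r \<le> p" "p - r \<le> d n" "r = 0 \<or> r = p - d n"
      using d0[of n] by (auto simp: p_def r_def max_def)
    have eq: "f n y = (p - r) * (p + r) / (2 * d n)"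
      by (simp add: f_def p_def r_def power2_eq_square algebra_simps)
    have "(p - r) * (p + r) \<le> d n * (2 * p)" using pr by (intro mult_mono) auto
    then have le: "f n y \<le> p" using d0[of n] by (simp add: eq field_simps)
    have ge: "0 \<le> f n y" using pr d0[of n] by (simp add: eq)
    show "\<bar>f n y\<bar> \<le> max 0 (y - x)" using le ge by (simp add: p_def)
    have "p - d n \<le> f n y"
      using pr(5)
    proof
      assume "r = 0" then show ?thesis using pr ge by linarith
    next
      assume "r = p - d n"
      then have "p - r = d n" "p + r = 2 * p - d n" by auto
      then have "f n y = p - d n / 2"
        unfolding eq using d0[of n] by (simp only:) (simp add: field_simps)
      then show ?thesis using d0[of n] by simp
    qed
    then show "\<bar>f n y - max 0 (y - x)\<bar> \<le> d n" using le d0[of n] by (simp add: p_def)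
  qed
  have [measurable]: "f n \<in> borel_measurable borel" "f' n \<in> borel_measurable borel" for n
    unfolding f_def[abs_def] f'_def[abs_def] by measurable
  have "(\<lambda>n. expectation (\<lambda>\<omega>. f n (W \<omega>))) \<longlonglongrightarrow> expectation (\<lambda>\<omega>. max 0 (W \<omega> - x))"
  proof (rule integral_dominated_convergence)
    show "integrable M (\<lambda>\<omega>. max 0 (W \<omega> - x))" using W by auto
    show "AE \<omega> in M. (\<lambda>n. f n (W \<omega>)) \<longlonglongrightarrow> max 0 (W \<omega> - x)"
    proof (rule AE_I2)
      fix \<omega>
      have "(\<lambda>n. f n (W \<omega>) - max 0 (W \<omega> - x)) \<longlonglongrightarrow> 0"
        by (rule Lim_null_comparison[OF _ dlim]) (simp add: f_close)
      then show "(\<lambda>n. f n (W \<omega>)) \<longlonglongrightarrow> max 0 (W \<omega> - x)" by (simp add: LIM_zero_iff)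
    qed
  qed (use f_bd in auto)
  moreover have "(\<lambda>n. expectation (\<lambda>\<omega>. f' n (We \<omega>)))
      \<longlonglongrightarrow> expectation (indicator {\<omega> \<in> space M. x < We \<omega>})"
  proof (rule integral_dominated_convergence)
    show "integrable M (\<lambda>\<omega>. 1::real)" by simp
    show "AE \<omega> in M. (\<lambda>n. f' n (We \<omega>)) \<longlonglongrightarrow> indicator {\<omega> \<in> space M. x < We \<omega>} \<omega>"
    proof (rule AE_I2)
      fix \<omega> assume "\<omega> \<in> space M"
      show "(\<lambda>n. f' n (We \<omega>)) \<longlonglongrightarrow> indicator {\<omega> \<in> space M. x < We \<omega>} \<omega>"
      proof (cases "x < We \<omega>")
        case True
        then have "\<forall>\<^sub>F n in sequentially. d n < We \<omega> - x"
          using order_tendstoD(2)[OF dlim, of "We \<omega> - x"] by simp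
        then have "\<forall>\<^sub>F n in sequentially. f' n (We \<omega>) = 1"
          by eventually_elim (use True in \<open>auto simp: f'_def max_def less_imp_neq[OF d0, symmetric]\<close>)
        then show ?thesis using True \<open>\<omega> \<in> space M\<close> by (simp add: tendsto_eventually)
      next
        case False
        have "f' n (We \<omega>) = 0" for n using False d0[of n] by (simp add: f'_def max_def)
        then show ?thesis using False by simp
      qed
    qed
  qed (use f'_bd in auto)
  moreover have "expectation (\<lambda>\<omega>. f n (W \<omega>)) = expectation (\<lambda>\<omega>. f' n (We \<omega>))" for n
    using equil[OF f_deriv f'_cont] f'_bd f_0 by simp
  ultimately have "expectation (\<lambda>\<omega>. max 0 (W \<omega> - x)) = expectation (indicator {\<omega> \<in> space M. x < We \<omega>})"
    using LIMSEQ_unique by auto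
  then show ?thesis by simp
qed

text \<open>A discrete Gronwall argument: [0, x] is cut into n equal steps and n tends to infinity.
  Only increments of \<open>H\<close> are used, so jumps of \<open>G\<close> do no harm. In the
  limit \<open>H\<close> is within b of exp(-x), and passing from \<open>H\<close> to
  \<open>G\<close> costs another b; this is the origin of 2 b.\<close>

lemma exp_decay_bounds:
  fixes G H :: "real \<Rightarrow> real"
  assumes H0: "H 0 = 1" and b: "0 \<le> b"
    and up: "\<And>x y. \<lbrakk>0 \<le> x; x \<le> y\<rbrakk> \<Longrightarrow> H x - H y \<le> (y - x) * G x"
    and lo: "\<And>x y. \<lbrakk>0 \<le> x; x \<le> y\<rbrakk> \<Longrightarrow> (y - x) * G y \<le> H x - H y"
    and G1: "\<And>x. 0 \<le> x \<Longrightarrow> G x \<le> H x + b" and G2: "\<And>x. 0 \<le> x \<Longrightarrow> H x - b \<le> G x"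
    and x: "0 \<le> x"
  shows "\<bar>G x - exp (- x)\<bar> \<le> 2 * b"
proof -
  \<comment> \<open>Explicit Euler steps: \<open>up\<close> takes \<open>G\<close> at the left end,
    where it is at most H + b, so H + b keeps at least the fraction 1 - x / n per step. The
    assumption x \<le> n keeps this factor nonnegative.\<close>
  have A: "(1 - x / n) ^ k * (1 + b) \<le> H (real k * (x / n)) + b" if n: "n > 0" "x \<le> n" for k and n :: real
  proof (induction k)
    case 0 then show ?case by (simp add: H0)
  next
    case (Suc k)
    let ?y = "real k * (x / n)"
    have y: "0 \<le> ?y" "real (Suc k) * (x / n) - ?y = x / n" "?y \<le> real (Suc k) * (x / n)"
      using x n by (auto simp: algebra_simps intro!: divide_right_mono mult_right_mono)
    have "H ?y - H (real (Suc k) * (x / n)) \<le> x / n * G ?y"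
      using up[OF y(1,3)] y(2) by simp
    also have "\<dots> \<le> x / n * (H ?y + b)"
      using G1[OF y(1)] x n by (intro mult_left_mono) auto
    finally have "(1 - x / n) * (H ?y + b) \<le> H (real (Suc k) * (x / n)) + b"
      by (simp add: algebra_simps)
    moreover have "(1 - x / n) * ((1 - x / n) ^ k * (1 + b)) \<le> (1 - x / n) * (H ?y + b)"
      using n by (intro mult_left_mono Suc.IH) auto
    ultimately show ?case by (simp add: mult.assoc)
  qed
  \<comment> \<open>Implicit Euler steps: \<open>lo\<close> takes \<open>G\<close> at the right end,
    where it is at least H - b, so H - b shrinks at least by the factor 1 + x / n. That factor is
    positive, hence the sign of H - b is irrelevant.\<close>
  have B: "(1 + x / n) ^ k * (H (real k * (x / n)) - b) \<le> 1 - b" if n: "n > 0" for k and n :: real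
  proof (induction k)
    case 0 then show ?case by (simp add: H0)
  next
    case (Suc k)
    let ?y = "real k * (x / n)" and ?z = "real (Suc k) * (x / n)"
    have y: "0 \<le> ?y" "?z - ?y = x / n" "?y \<le> ?z" "0 \<le> ?z"
      using x n by (auto simp: algebra_simps intro!: divide_right_mono mult_right_mono)
    have "x / n * (H ?z - b) \<le> x / n * G ?z"
      using G2[OF y(4)] x n by (intro mult_left_mono) auto
    also have "\<dots> \<le> H ?y - H ?z"
      using lo[OF y(1,3)] y(2) by simp
    finally have "(1 + x / n) * (H ?z - b) \<le> H ?y - b"
      by (simp add: algebra_simps)
    then have "(1 + x / n) ^ k * ((1 + x / n) * (H ?z - b)) \<le> (1 + x / n) ^ k * (H ?y - b)"
      using x n by (intro mult_left_mono) auto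
    also have "\<dots> \<le> 1 - b" by (rule Suc.IH)
    finally show ?case by (simp add: mult_ac)
  qed
  have "(\<lambda>n. (1 + (- x) / real n) ^ n * (1 + b)) \<longlonglongrightarrow> exp (- x) * (1 + b)"
    by (intro tendsto_intros tendsto_exp_limit_sequentially)
  moreover have "\<forall>\<^sub>F n in sequentially. (1 + (- x) / real n) ^ n * (1 + b) \<le> H x + b"
    using eventually_gt_at_top[of "nat \<lceil>x\<rceil>"]
  proof eventually_elim
    case (elim n)
    then have "n > 0" "x \<le> real n" by linarith+
    then show ?case using A[of "real n" n] by simp
  qed
  ultimately have 1: "exp (- x) * (1 + b) \<le> H x + b"
    by (rule tendsto_upperbound) simp
  have "(\<lambda>n. (1 + x / real n) ^ n * (H x - b)) \<longlonglongrightarrow> exp x * (H x - b)"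
    by (intro tendsto_intros tendsto_exp_limit_sequentially)
  moreover have "\<forall>\<^sub>F n in sequentially. (1 + x / real n) ^ n * (H x - b) \<le> 1 - b"
    using eventually_gt_at_top[of 0]
  proof eventually_elim
    case (elim n)
    then show ?case using B[of "real n" n] by simp
  qed
  ultimately have "exp x * (H x - b) \<le> 1 - b"
    by (rule tendsto_upperbound) simp
  then have "exp (- x) * (exp x * (H x - b)) \<le> exp (- x) * (1 - b)"
    by (rule mult_left_mono) simp
  then have 2: "H x - b \<le> exp (- x) * (1 - b)"
    by (simp only: mult.assoc[symmetric] exp_minus_inverse[of "- x", simplified]) simp
  have "0 \<le> exp (- x) * b" "exp (- x) * b \<le> b"
    using b x by (auto simp: mult_left_le_one_le)
  then show ?thesis
    using 1 2 G1[OF x] G2[OF x] unfolding distrib_left right_diff_distrib mult_1_right by linarith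
qed

text \<open>With \<open>H x = P(We > x) = E (W - x)\<^sup>+\<close> and \<open>G x = P(W > x)\<close> one has \<open>H' = - G\<close> (up to jumps),
  and the two comparison hypotheses say \<open>\<bar>G - H\<bar> \<le> b\<close> since \<open>H\<close> is \<open>1\<close>-Lipschitz.
  Thus \<open>H\<close> nearly satisfies \<open>H' = - H\<close>, \<open>H 0 = 1\<close>.\<close>

lemma (in prob_space) kolmogorov_exp1_le:
  fixes W We :: "'a \<Rightarrow> real"
  assumes W: "integrable M W" and W0: "AE \<omega> in M. 0 \<le> W \<omega>" and EW: "expectation W = 1"
    and We [measurable]: "We \<in> borel_measurable M"
    and equil: "\<And>f f' :: real \<Rightarrow> real. \<lbrakk>\<And>x. (f has_real_derivative f' x) (at x); continuous_on UNIV f';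
        \<And>x. \<bar>f' x\<bar> \<le> 1\<rbrakk> \<Longrightarrow> expectation (\<lambda>\<omega>. f (W \<omega>)) - f 0 = expectation (\<lambda>\<omega>. f' (We \<omega>))"
    and b: "0 \<le> b"
    and dom1: "\<And>x. prob {\<omega> \<in> space M. x + b < W \<omega>} \<le> prob {\<omega> \<in> space M. x < We \<omega>}"
    and dom2: "\<And>x. prob {\<omega> \<in> space M. x + b < We \<omega>} \<le> prob {\<omega> \<in> space M. x < W \<omega>}"
  shows "kolmogorov_dist (distr M borel W) exp1 \<le> ennreal (2 * b)"
proof -
  have [measurable]: "W \<in> borel_measurable M" using W by auto
  define G where "G x = prob {\<omega> \<in> space M. x < W \<omega>}" for x
  define H where "H x = expectation (\<lambda>\<omega>. max 0 (W \<omega> - x))" for x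
  have H: "prob {\<omega> \<in> space M. x < We \<omega>} = H x" if "0 \<le> x" for x
    unfolding H_def using W We equil that by (rule equilibrium_tail)
  have intH: "integrable M (\<lambda>\<omega>. max 0 (W \<omega> - x))" for x using W by auto
  have H_diff: "H x - H y = expectation (\<lambda>\<omega>. max 0 (W \<omega> - x) - max 0 (W \<omega> - y))" for x y
    unfolding H_def by (rule Bochner_Integration.integral_diff[symmetric]) (rule intH)+
  have G_eq: "c * G x = expectation (\<lambda>\<omega>. c * indicator {\<omega> \<in> space M. x < W \<omega>} \<omega>)" for c x
    unfolding G_def by simp
  have intI: "integrable M (\<lambda>\<omega>. c * indicator {\<omega> \<in> space M. x < W \<omega>} \<omega>)" for c x :: real
    by (intro integrable_mult_right integrable_real_indicator) (auto simp: less_top[symmetric])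
  have up: "H x - H y \<le> (y - x) * G x" if "x \<le> y" for x y
    unfolding H_diff G_eq
  proof (rule integral_mono)
    show "max 0 (W \<omega> - x) - max 0 (W \<omega> - y) \<le> (y - x) * indicator {\<omega> \<in> space M. x < W \<omega>} \<omega>"
      if "\<omega> \<in> space M" for \<omega>
      using that \<open>x \<le> y\<close> by (auto split: split_indicator)
  qed (intro intH intI Bochner_Integration.integrable_diff)+
  have lo: "(y - x) * G y \<le> H x - H y" if "x \<le> y" for x y
    unfolding H_diff G_eq
  proof (rule integral_mono)
    show "(y - x) * indicator {\<omega> \<in> space M. y < W \<omega>} \<omega> \<le> max 0 (W \<omega> - x) - max 0 (W \<omega> - y)"
      if "\<omega> \<in> space M" for \<omega>
      using that \<open>x \<le> y\<close> by (auto split: split_indicator)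
  qed (intro intH intI Bochner_Integration.integrable_diff)+
  have H0: "H 0 = 1"
    unfolding H_def EW[symmetric] by (rule integral_cong_AE) (use W0 in auto)
  have G_bd: "0 \<le> G x" "G x \<le> 1" for x by (auto simp: G_def)
  have lip: "H x \<le> H y + (y - x)" if "x \<le> y" for x y
  proof -
    have "(y - x) * G x \<le> (y - x) * 1" using that G_bd(2)[of x] by (intro mult_left_mono) auto
    then show ?thesis using up[OF that] by simp
  qed
  have G1: "G x \<le> H x + b" if x: "0 \<le> x" for x
  proof (cases "b \<le> x")
    case True
    have "G x \<le> H (x - b)" using dom1[of "x - b"] H[of "x - b"] True by (simp add: G_def)
    also have "\<dots> \<le> H x + b" using lip[of "x - b" x] b by simp
    finally show ?thesis .
  next
    \<comment> \<open>Here x - b is negative and the tail of \<open>We\<close> there is not given by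
      \<open>H\<close>. The trivial bound G \<le> 1 = H 0 \<le> H x + x suffices because x <
      b.\<close>
    case False
    then show ?thesis using G_bd(2)[of x] lip[of 0 x] H0 x by simp
  qed
  \<comment> \<open>\<open>dom2\<close> at x gives H (x + b) \<le> G x, and moving \<open>H\<close>
    back by b costs at most b by \<open>lip\<close>.\<close>
  have G2: "H x - b \<le> G x" if x: "0 \<le> x" for x
    using dom2[of x] H[of "x + b"] lip[of x "x + b"] x b by (simp add: G_def)
  have cdf_W: "cdf (distr M borel W) z = 1 - G z" for z
  proof -
    have "cdf (distr M borel W) z = prob {\<omega> \<in> space M. W \<omega> \<le> z}"
      by (simp add: cdf_def measure_distr vimage_def Int_def conj_commute)
    also have "{\<omega> \<in> space M. W \<omega> \<le> z} = space M - {\<omega> \<in> space M. z < W \<omega>}" by auto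
    also have "prob \<dots> = 1 - G z" unfolding G_def by (rule prob_compl) measurable
    finally show ?thesis .
  qed
  have "\<bar>cdf (distr M borel W) z - cdf exp1 z\<bar> \<le> 2 * b" for z
  proof (cases "z < 0")
    case True
    have "G z = 1"
      unfolding G_def using W0 True by (subst prob_eq_1) auto
    then show ?thesis using True b by (simp add: cdf_W cdf_exp1)
  next
    case False
    then have "\<bar>G z - exp (- z)\<bar> \<le> 2 * b"
      by (intro exp_decay_bounds[of H] H0 b up lo G1 G2) auto
    then show ?thesis using False by (simp add: cdf_W cdf_exp1 abs_minus_commute)
  qed
  then show ?thesis
    unfolding kolmogorov_dist_def by (intro SUP_least ennreal_leI)
qed

section \<open>Regular conditional laws, independence and quantiles\<close>

text \<open>\<open>regular_cond_law\<close> provides an almost sure equation for each fixed set,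
  with an exceptional null set depending on the set. This upgrades it to integrands that also depend
  on \<omega> through \<open>F\<close>: the joint law of \<omega> and Y \<omega> on F \<Otimes>
  borel equals a kernel composition, since both agree on rectangles and these form a generating
  pi-system.\<close>

lemma (in prob_space) nn_integral_regular_cond_law:
  assumes sub: "subalgebra M F" and Y [measurable]: "Y \<in> borel_measurable M"
    and reg: "regular_cond_law M F Y \<kappa>"
    and g: "(\<lambda>(\<omega>, y). g \<omega> y) \<in> borel_measurable (F \<Otimes>\<^sub>M borel)"
  shows "(\<integral>\<^sup>+\<omega>. g \<omega> (Y \<omega>) \<partial>M) = (\<integral>\<^sup>+\<omega>. \<integral>\<^sup>+y. g \<omega> y \<partial>\<kappa> \<omega> \<partial>M)"
proof -
  interpret finite_measure_subalgebra M F by standard (rule sub)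
  let ?R = "restr_to_subalg M F" and ?B = "F \<Otimes>\<^sub>M (borel :: real measure)"
  have space_F: "space F = space M" and sets_F: "sets F \<subseteq> sets M"
    using sub by (auto simp: subalgebra_def)
  have kF: "\<kappa> \<in> F \<rightarrow>\<^sub>M prob_algebra borel"
    and kE: "\<And>A. A \<in> sets borel \<Longrightarrow> AE \<omega> in M.
        measure (\<kappa> \<omega>) A = real_cond_exp M F (\<lambda>\<omega>'. indicator A (Y \<omega>')) \<omega>"
    using reg by (auto simp: regular_cond_law_def)
  have kF' [measurable]: "\<kappa> \<in> F \<rightarrow>\<^sub>M subprob_algebra borel"
    using kF by (rule measurable_prob_algebraD)
  have k_prob: "prob_space (\<kappa> \<omega>)" and k_sets: "sets (\<kappa> \<omega>) = sets borel" if "\<omega> \<in> space M" for \<omega>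
    using measurable_space[OF kF] that by (auto simp: space_F space_prob_algebra)
  \<comment> \<open>\<open>K \<omega>\<close> is the law of the pair (\<omega>, y) with \<omega>
    frozen and y drawn from \<open>\<kappa> \<omega>\<close>. As \<open>\<kappa>\<close> is
    measurable for \<open>F\<close>, the kernel is composed with the restriction of the measure to
    \<open>F\<close>.\<close>
  define K where "K \<omega> = distr (\<kappa> \<omega>) ?B (Pair \<omega>)" for \<omega>
  have K: "K \<in> F \<rightarrow>\<^sub>M subprob_algebra ?B"
    unfolding K_def by (rule measurable_distr2[where M = borel]) (simp_all add: kF' case_prod_Pair_iden)
  have KR: "K \<in> ?R \<rightarrow>\<^sub>M subprob_algebra ?B"
    using K by (rule measurable_in_subalg[OF sub])
  have Pair_meas: "Pair \<omega> \<in> \<kappa> \<omega> \<rightarrow>\<^sub>M ?B" if "\<omega> \<in> space M" for \<omega>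
    using that k_sets[OF that] by (simp add: space_F cong: measurable_cong_sets)
  have graph: "(\<lambda>\<omega>. (\<omega>, Y \<omega>)) \<in> M \<rightarrow>\<^sub>M ?B"
    by (intro measurable_Pair Y measurable_from_subalg[OF sub]) simp
  have ne: "space ?R \<noteq> {}" using not_empty by (simp add: space_restr_to_subalg)
  have eq: "distr M ?B (\<lambda>\<omega>. (\<omega>, Y \<omega>)) = ?R \<bind> K"
  proof (rule measure_eqI_generator_eq[where A = "\<lambda>_. space F \<times> space borel",
        OF Int_stable_pair_measure_generator[of F borel]])
    show "{a \<times> b |a b. a \<in> sets F \<and> b \<in> sets (borel::real measure)} \<subseteq> Pow (space F \<times> space borel)"
      by (auto dest: sets.sets_into_space)
    show "sets (distr M ?B (\<lambda>\<omega>. (\<omega>, Y \<omega>))) =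
        sigma_sets (space F \<times> space borel) {a \<times> b |a b. a \<in> sets F \<and> b \<in> sets (borel::real measure)}"
      by (simp add: sets_pair_measure)
    show "sets (?R \<bind> K) =
        sigma_sets (space F \<times> space borel) {a \<times> b |a b. a \<in> sets F \<and> b \<in> sets (borel::real measure)}"
      using sets_bind[OF sets_kernel[OF KR] ne] by (simp add: sets_pair_measure)
    show "range (\<lambda>_. space F \<times> space (borel::real measure))
        \<subseteq> {a \<times> b |a b. a \<in> sets F \<and> b \<in> sets (borel::real measure)}"
      using sets.top[of F] sets.top[of "borel :: real measure"] by blast
    show "(\<Union>i. space F \<times> space borel) = space F \<times> space (borel::real measure)" by auto
    show "emeasure (distr M ?B (\<lambda>\<omega>. (\<omega>, Y \<omega>))) (space F \<times> space borel) \<noteq> \<infinity>" for i :: nat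
      using graph by (subst emeasure_distr) auto
  next
    fix Z assume "Z \<in> {a \<times> b |a b. a \<in> sets F \<and> b \<in> sets (borel::real measure)}"
    then obtain a b where Z: "Z = a \<times> b" and a: "a \<in> sets F" and b [measurable]: "b \<in> sets borel" by auto
    have aM [measurable]: "a \<in> sets M" using a sets_F by auto
    have "emeasure (distr M ?B (\<lambda>\<omega>. (\<omega>, Y \<omega>))) Z = emeasure M {\<omega> \<in> space M. \<omega> \<in> a \<and> Y \<omega> \<in> b}"
      using graph a b by (subst emeasure_distr) (auto simp: Z intro!: arg_cong[where f = "emeasure M"])
    also have "\<dots> = ennreal (prob {\<omega> \<in> space M. \<omega> \<in> a \<and> Y \<omega> \<in> b})"
      by (rule emeasure_eq_measure)
    also have "prob {\<omega> \<in> space M. \<omega> \<in> a \<and> Y \<omega> \<in> b} = (\<integral>\<omega>. indicator {\<omega> \<in> space M. \<omega> \<in> a \<and> Y \<omega> \<in> b} \<omega> \<partial>M)"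
      by simp
    also have "\<dots> = (\<integral>\<omega>\<in>a. indicator b (Y \<omega>) \<partial>M)"
      unfolding set_lebesgue_integral_def
      by (rule Bochner_Integration.integral_cong) (auto split: split_indicator)
    \<comment> \<open>On a rectangle the claim is the defining property of conditional expectation,
      as the side \<open>a\<close> belongs to \<open>F\<close>.\<close>
    also have "\<dots> = (\<integral>\<omega>\<in>a. real_cond_exp M F (\<lambda>\<omega>'. indicator b (Y \<omega>')) \<omega> \<partial>M)"
      by (rule real_cond_exp_intA[OF _ a]) (auto intro!: integrable_const_bound[where B = 1])
    also have "\<dots> = (\<integral>\<omega>. indicator a \<omega> * measure (\<kappa> \<omega>) b \<partial>M)"
      unfolding set_lebesgue_integral_def real_scaleR_def
    proof (rule integral_cong_AE)
      show "(\<lambda>\<omega>. indicator a \<omega> * measure (\<kappa> \<omega>) b) \<in> borel_measurable M"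
        by (rule measurable_from_subalg[OF sub]) (use a in measurable)
      show "AE \<omega> in M. indicator a \<omega> * real_cond_exp M F (\<lambda>\<omega>'. indicator b (Y \<omega>')) \<omega>
          = indicator a \<omega> * measure (\<kappa> \<omega>) b"
        using kE[OF b] by eventually_elim simp
    qed measurable
    also have "ennreal \<dots> = (\<integral>\<^sup>+\<omega>. ennreal (indicator a \<omega> * measure (\<kappa> \<omega>) b) \<partial>M)"
    proof (rule nn_integral_eq_integral[symmetric])
      show "integrable M (\<lambda>\<omega>. indicator a \<omega> * measure (\<kappa> \<omega>) b)"
      proof (rule integrable_const_bound[where B = 1])
        show "(\<lambda>\<omega>. indicator a \<omega> * measure (\<kappa> \<omega>) b) \<in> borel_measurable M"
          by (rule measurable_from_subalg[OF sub]) (use a in measurable)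
        show "AE \<omega> in M. norm (indicator a \<omega> * measure (\<kappa> \<omega>) b) \<le> 1"
          using k_prob by (auto split: split_indicator intro!: AE_I2 prob_space.prob_le_1)
      qed
    qed simp
    also have "\<dots> = (\<integral>\<^sup>+\<omega>. emeasure (K \<omega>) Z \<partial>M)"
    proof (rule nn_integral_cong)
      fix \<omega> assume w: "\<omega> \<in> space M"
      interpret k: prob_space "\<kappa> \<omega>" by (rule k_prob[OF w])
      have "emeasure (K \<omega>) Z = emeasure (\<kappa> \<omega>) (Pair \<omega> -` Z \<inter> space (\<kappa> \<omega>))"
        unfolding K_def using a b by (intro emeasure_distr Pair_meas[OF w]) (auto simp: Z)
      also have "Pair \<omega> -` Z \<inter> space (\<kappa> \<omega>) = (if \<omega> \<in> a then b else {})"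
        using sets_eq_imp_space_eq[OF k_sets[OF w]] by (auto simp: Z)
      finally show "ennreal (indicator a \<omega> * measure (\<kappa> \<omega>) b) = emeasure (K \<omega>) Z"
        by (simp add: k.emeasure_eq_measure)
    qed
    also have "\<dots> = (\<integral>\<^sup>+\<omega>. emeasure (K \<omega>) Z \<partial>?R)"
      using K a b
      by (intro nn_integral_subalgebra2[OF sub, symmetric] measurable_emeasure_kernel[OF K]) (auto simp: Z)
    also have "\<dots> = emeasure (?R \<bind> K) Z"
      using a b by (intro emeasure_bind[OF ne KR, symmetric]) (auto simp: Z)
    finally show "emeasure (distr M ?B (\<lambda>\<omega>. (\<omega>, Y \<omega>))) Z = emeasure (?R \<bind> K) Z" .
  qed
  have "(\<integral>\<^sup>+\<omega>. g \<omega> (Y \<omega>) \<partial>M) = (\<integral>\<^sup>+z. (case z of (\<omega>, y) \<Rightarrow> g \<omega> y) \<partial>distr M ?B (\<lambda>\<omega>. (\<omega>, Y \<omega>)))"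
    using g by (subst nn_integral_distr[OF graph]) simp_all
  also have "\<dots> = (\<integral>\<^sup>+\<omega>. \<integral>\<^sup>+z. (case z of (\<omega>, y) \<Rightarrow> g \<omega> y) \<partial>K \<omega> \<partial>?R)"
    unfolding eq by (rule nn_integral_bind[OF g KR])
  also have "\<dots> = (\<integral>\<^sup>+\<omega>. \<integral>\<^sup>+y. g \<omega> y \<partial>\<kappa> \<omega> \<partial>?R)"
    unfolding K_def
    by (intro nn_integral_cong) (simp add: nn_integral_distr[OF Pair_meas] g space_restr_to_subalg)
  also have "\<dots> = (\<integral>\<^sup>+\<omega>. \<integral>\<^sup>+y. g \<omega> y \<partial>\<kappa> \<omega> \<partial>M)"
    by (intro nn_integral_subalgebra2[OF sub] nn_integral_measurable_subprob_algebra2[OF g kF'])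
  finally show ?thesis .
qed

text \<open>Independence says that, on \<open>F\<close>, the measure with density the indicator of
  \<open>E\<close> is the original measure scaled by the mass of \<open>E\<close>. Equality of the
  measures yields the product formula for every \<open>g\<close> at once.\<close>

lemma (in prob_space) nn_integral_indep_set:
  assumes sub: "subalgebra M F" and indep: "indep_set (sets F) B"
    and E: "E \<in> B" and g: "g \<in> borel_measurable F"
  shows "(\<integral>\<^sup>+\<omega>. indicator E \<omega> * g \<omega> \<partial>M) = emeasure M E * (\<integral>\<^sup>+\<omega>. g \<omega> \<partial>M)"
proof -
  have EM [measurable]: "E \<in> sets M" using indep E by (auto dest: indep_setD_ev2)
  have subD: "subalgebra (density M (indicator E)) F" using sub by (simp add: subalgebra_def)
  have gM: "g \<in> borel_measurable M" by (rule measurable_from_subalg[OF sub g])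
  have "restr_to_subalg (density M (indicator E)) F = scale_measure (emeasure M E) (restr_to_subalg M F)"
  proof (rule measure_eqI)
    show "sets (restr_to_subalg (density M (indicator E)) F)
        = sets (scale_measure (emeasure M E) (restr_to_subalg M F))"
      using sub subD by (simp add: sets_restr_to_subalg)
    fix A assume "A \<in> sets (restr_to_subalg (density M (indicator E)) F)"
    then have A: "A \<in> sets F" using subD by (simp add: sets_restr_to_subalg)
    then have AM [measurable]: "A \<in> sets M" using sub by (auto simp: subalgebra_def)
    have "emeasure (restr_to_subalg (density M (indicator E)) F) A = (\<integral>\<^sup>+\<omega>. indicator E \<omega> * indicator A \<omega> \<partial>M)"
      using A by (simp add: emeasure_restr_to_subalg[OF subD] emeasure_density)
    also have "\<dots> = emeasure M (A \<inter> E)"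
      unfolding indicator_inter_arith[symmetric] by (simp add: Int_commute)
    also have "\<dots> = emeasure M E * emeasure M A"
      using indep_setD[OF indep A E] by (simp add: emeasure_eq_measure ennreal_mult' mult.commute)
    finally show "emeasure (restr_to_subalg (density M (indicator E)) F) A
        = emeasure (scale_measure (emeasure M E) (restr_to_subalg M F)) A"
      using A by (simp add: emeasure_restr_to_subalg[OF sub])
  qed
  then have "(\<integral>\<^sup>+\<omega>. g \<omega> \<partial>restr_to_subalg (density M (indicator E)) F)
      = (\<integral>\<^sup>+\<omega>. g \<omega> \<partial>scale_measure (emeasure M E) (restr_to_subalg M F))" by simp
  then show ?thesis
    using g gM measurable_in_subalg[OF sub g]
    by (simp add: nn_integral_subalgebra2[OF subD] nn_integral_subalgebra2[OF sub]
        nn_integral_density nn_integral_scale_measure)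
qed

section \<open>Quantile distance and comparison of tails\<close>

lemma quantile_sup_dist_commute: "quantile_sup_dist Q R = quantile_sup_dist R Q"
  by (simp add: quantile_sup_dist_def abs_minus_commute)

text \<open>Equivalently, \<open>cdf R x\<close> is at most \<open>cdf Q (x + q)\<close>. A level
  \<open>u\<close> strictly between, were the order reversed, would have its R-quantile at most x
  but its Q-quantile beyond x + q.\<close>

lemma measure_greaterThan_le_of_quantile_sup_dist:
  assumes "real_distribution Q" "real_distribution R"
    and q: "quantile_sup_dist Q R \<le> ennreal q" "0 \<le> q"
  shows "measure Q {x + q<..} \<le> measure R {x<..}"
proof -
  interpret Q: real_distribution Q by fact
  interpret R: real_distribution R by fact
  interpret Q: cdf_distribution Q by standard
  interpret R: cdf_distribution R by standard
  have "cdf R x \<le> cdf Q (x + q)"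
  proof (rule ccontr)
    assume "\<not> cdf R x \<le> cdf Q (x + q)"
    then obtain u where u: "cdf Q (x + q) < u" "u < cdf R x" using dense[of "cdf Q (x + q)" "cdf R x"] by auto
    have u01: "0 < u" "u < 1"
      using u Q.cdf_nonneg[of "x + q"] R.cdf_bounded_prob[of x] by linarith+
    have "ennreal \<bar>gen_inverse (cdf Q) u - gen_inverse (cdf R) u\<bar> \<le> quantile_sup_dist Q R"
      unfolding quantile_sup_dist_def using u01 by (intro SUP_upper) auto
    also note q(1)
    finally have "\<bar>gen_inverse (cdf Q) u - gen_inverse (cdf R) u\<bar> \<le> q"
      using q(2) by simp
    moreover have "gen_inverse (cdf R) u \<le> x"
      using R.pseudoinverse[OF u01, of x] u by (simp add: gen_inverse_def)
    ultimately have "gen_inverse (cdf Q) u \<le> x + q" by simp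
    then show False
      using Q.pseudoinverse[OF u01, of "x + q"] u by (simp add: gen_inverse_def)
  qed
  moreover have "measure Q {x + q<..} = 1 - cdf Q (x + q)"
    unfolding cdf_def by (subst Q.prob_compl[symmetric]) (auto intro!: arg_cong[where f = "measure Q"])
  moreover have "measure R {x<..} = 1 - cdf R x"
    unfolding cdf_def by (subst R.prob_compl[symmetric]) (auto intro!: arg_cong[where f = "measure R"])
  ultimately show ?thesis by simp
qed

lemma lipschitz_of_deriv_bound:
  fixes f :: "real \<Rightarrow> real"
  assumes D: "\<And>x. (f has_real_derivative f' x) (at x)" and bd: "\<And>x. \<bar>f' x\<bar> \<le> L"
  shows "L-lipschitz_on UNIV f"
proof (rule lipschitz_onI)
  show "0 \<le> L" using bd[of 0] by linarith
  fix x y :: real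
  have "norm (f x - f y) \<le> L * norm (x - y)"
    by (rule field_differentiable_bound[of UNIV f f']) (use D bd in auto)
  then show "dist (f x) (f y) \<le> L * dist x y" by (simp add: dist_norm)
qed

lemma regular_cond_law_real_distribution:
  assumes "regular_cond_law P F Y \<kappa>" "subalgebra P F" "\<omega> \<in> space P"
  shows "real_distribution (\<kappa> \<omega>)"
proof -
  have "\<kappa> \<in> F \<rightarrow>\<^sub>M prob_algebra borel" using assms by (simp add: regular_cond_law_def)
  then have "\<kappa> \<omega> \<in> space (prob_algebra borel)"
    by (rule measurable_space) (use assms in \<open>auto simp: subalgebra_def\<close>)
  then show ?thesis
    by (auto simp: space_prob_algebra real_distribution_def real_distribution_axioms_def
        dest: sets_eq_imp_space_eq)
qed

text \<open>Conditioning on \<open>F\<close> freezes \<open>s\<close>, which reduces the claim to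
  the conditional laws at level x - s \<omega>. As that level is random, the quantifier over x in
  \<open>le\<close> has to stand inside the almost sure statement.\<close>

lemma (in prob_space) regular_cond_law_tail_mono:
  assumes sub: "subalgebra M F"
    and Y [measurable]: "Y \<in> borel_measurable M" and Y' [measurable]: "Y' \<in> borel_measurable M"
    and reg: "regular_cond_law M F Y \<kappa>" and reg': "regular_cond_law M F Y' \<kappa>'"
    and s [measurable]: "s \<in> borel_measurable F"
    and le: "AE \<omega> in M. \<forall>x. measure (\<kappa> \<omega>) {x + q<..} \<le> measure (\<kappa>' \<omega>) {x<..}"
  shows "(\<integral>\<^sup>+\<omega>. indicator {x + q<..} (s \<omega> + Y \<omega>) \<partial>M) \<le> (\<integral>\<^sup>+\<omega>. indicator {x<..} (s \<omega> + Y' \<omega>) \<partial>M)"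
proof -
  have eq: "(\<integral>\<^sup>+\<omega>. indicator {z<..} (s \<omega> + Z \<omega>) \<partial>M) = (\<integral>\<^sup>+\<omega>. emeasure (l \<omega>) {z - s \<omega><..} \<partial>M)"
    if Z: "Z \<in> borel_measurable M" and l: "regular_cond_law M F Z l" for Z l z
  proof -
    have "(\<integral>\<^sup>+\<omega>. indicator {z<..} (s \<omega> + Z \<omega>) \<partial>M)
        = (\<integral>\<^sup>+\<omega>. \<integral>\<^sup>+y. indicator {z<..} (s \<omega> + y) \<partial>l \<omega> \<partial>M)"
      by (rule nn_integral_regular_cond_law[OF sub Z l]) measurable
    also have "\<dots> = (\<integral>\<^sup>+\<omega>. emeasure (l \<omega>) {z - s \<omega><..} \<partial>M)"
    proof (rule nn_integral_cong)
      fix \<omega> assume w: "\<omega> \<in> space M"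
      interpret l: real_distribution "l \<omega>"
        by (rule regular_cond_law_real_distribution[OF l sub w])
      have "(\<integral>\<^sup>+y. indicator {z<..} (s \<omega> + y) \<partial>l \<omega>) = (\<integral>\<^sup>+y. indicator {z - s \<omega><..} y \<partial>l \<omega>)"
        by (rule nn_integral_cong) (auto split: split_indicator)
      then show "(\<integral>\<^sup>+y. indicator {z<..} (s \<omega> + y) \<partial>l \<omega>) = emeasure (l \<omega>) {z - s \<omega><..}"
        by simp
    qed
    finally show ?thesis .
  qed
  show ?thesis
    unfolding eq[OF Y reg] eq[OF Y' reg']
  proof (rule nn_integral_mono_AE)
    show "AE \<omega> in M. emeasure (\<kappa> \<omega>) {x + q - s \<omega><..} \<le> emeasure (\<kappa>' \<omega>) {x - s \<omega><..}"
      using le AE_space[of M]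
    proof eventually_elim
      case (elim \<omega>)
      interpret k: real_distribution "\<kappa> \<omega>"
        by (rule regular_cond_law_real_distribution[OF reg sub elim(2)])
      interpret k': real_distribution "\<kappa>' \<omega>"
        by (rule regular_cond_law_real_distribution[OF reg' sub elim(2)])
      show ?case
        using elim(1)[rule_format, of "x - s \<omega>"]
        by (simp add: k.emeasure_eq_measure k'.emeasure_eq_measure algebra_simps)
    qed
  qed
qed

section \<open>Random sums\<close>

locale random_sum = prob_space P for P :: "'a measure" +
  fixes X Xe :: "nat \<Rightarrow> 'a \<Rightarrow> real"
    and N M :: "'a \<Rightarrow> nat"
    and mu :: "nat \<Rightarrow> real"
    and \<mu> :: real
    and \<kappa> \<kappa>e :: "nat \<Rightarrow> 'a \<Rightarrow> real measure"
  assumes X_rv: "\<And>i. i \<ge> 1 \<Longrightarrow> X i \<in> borel_measurable P"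
    and X_sq: "\<And>i. i \<ge> 1 \<Longrightarrow> integrable P (\<lambda>\<omega>. (X i \<omega>)\<^sup>2)"
    and X_nonneg: "\<And>i. i \<ge> 1 \<Longrightarrow> AE \<omega> in P. 0 \<le> X i \<omega>"
    and X_cond: "\<And>i. i \<ge> 1 \<Longrightarrow> AE \<omega> in P. real_cond_exp P (past P X i) (X i) \<omega> = mu i"
    and N_rv: "N \<in> P \<rightarrow>\<^sub>M count_space UNIV"
    and mu_def: "has_bochner_integral P (\<lambda>\<omega>. \<Sum>i = 1..N \<omega>. X i \<omega>) \<mu>"
    and mu_pos: "0 < \<mu>"
    and M_rv: "M \<in> P \<rightarrow>\<^sub>M count_space UNIV"
    and M_law: "\<And>m. m \<ge> 1 \<Longrightarrow>
        measure P {\<omega> \<in> space P. M \<omega> = m} = mu m * measure P {\<omega> \<in> space P. N \<omega> \<ge> m} / \<mu>"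
    and Xe_rv: "\<And>i. i \<ge> 1 \<Longrightarrow> Xe i \<in> borel_measurable P"
    and X_law: "\<And>i. i \<ge> 1 \<Longrightarrow> regular_cond_law P (past P X i) (X i) (\<kappa> i)"
    and Xe_law: "\<And>i. i \<ge> 1 \<Longrightarrow> regular_cond_law P (past P X i) (Xe i) (\<kappa>e i)"
    and Xe_equilibrium: "\<And>i. i \<ge> 1 \<Longrightarrow> AE \<omega> in P. equilibrium_law (\<kappa> i \<omega>) (\<kappa>e i \<omega>)"
    and indep: "indep_set
        (sets (vimage_algebra (space P) (\<lambda>\<omega>. \<lambda>i\<in>{1..}. (X i \<omega>, Xe i \<omega>))
          (\<Pi>\<^sub>M i\<in>{1..}. borel \<Otimes>\<^sub>M borel)))
        (sets (vimage_algebra (space P) (\<lambda>\<omega>. (N \<omega>, M \<omega>)) (count_space UNIV)))"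
begin

declare N_rv [measurable] M_rv [measurable]

section \<open>Partial sums and their measurability\<close>

definition seq_algebra :: "'a measure" where
  "seq_algebra = vimage_algebra (space P) (\<lambda>\<omega>. \<lambda>i\<in>{1..}. (X i \<omega>, Xe i \<omega>))
     (\<Pi>\<^sub>M i\<in>{1..}. borel \<Otimes>\<^sub>M borel)"

definition S :: "nat \<Rightarrow> 'a \<Rightarrow> real" where
  "S n \<omega> = (\<Sum>i<n. X (Suc i) \<omega>)"

text \<open>The index is shifted so that \<open>T (M - 1)\<close> is S (M - 1) + Xe M for M \<ge> 1.
  On the null event M = 0 it involves \<open>Xe 1\<close> rather than the unconstrained
  \<open>Xe 0\<close>, and so it is measurable everywhere.\<close>

definition T :: "nat \<Rightarrow> 'a \<Rightarrow> real" where
  "T m \<omega> = S m \<omega> + Xe (Suc m) \<omega>"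

lemma sum_eq_S: "(\<Sum>i = 1..n. X i \<omega>) = S n \<omega>"
  by (simp add: S_def sum.atLeast1_atMost_eq)

lemma subalgebra_past: "subalgebra P (past P X i)"
proof -
  have "(\<lambda>\<omega>. \<lambda>j\<in>{1..<i}. X j \<omega>) \<in> P \<rightarrow>\<^sub>M (\<Pi>\<^sub>M j\<in>{1..<i}. borel)"
    by (intro measurable_restrict X_rv) auto
  then show ?thesis
    unfolding subalgebra_def past_def by (auto dest!: sets_image_in_sets[rotated])
qed

lemma subalgebra_seq: "subalgebra P seq_algebra"
proof -
  have "(\<lambda>\<omega>. \<lambda>i\<in>{1..}. (X i \<omega>, Xe i \<omega>)) \<in> P \<rightarrow>\<^sub>M (\<Pi>\<^sub>M i\<in>{1..}. borel \<Otimes>\<^sub>M borel)"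
    by (intro measurable_restrict measurable_Pair X_rv Xe_rv) auto
  then show ?thesis
    unfolding subalgebra_def seq_algebra_def by (auto dest!: sets_image_in_sets[rotated])
qed

lemma X_measurable_past:
  assumes "1 \<le> j" "j < i" shows "X j \<in> borel_measurable (past P X i)"
proof -
  have "(\<lambda>\<omega>. \<lambda>j\<in>{1..<i}. X j \<omega>) \<in> past P X i \<rightarrow>\<^sub>M (\<Pi>\<^sub>M j\<in>{1..<i}. borel)"
    unfolding past_def by (rule measurable_vimage_algebra1) (auto simp: space_PiM)
  then have "(\<lambda>\<omega>. (\<lambda>j\<in>{1..<i}. X j \<omega>) j) \<in> borel_measurable (past P X i)"
    by (rule measurable_compose) (rule measurable_component_singleton, use assms in auto)
  then show ?thesis using assms by simp
qed

lemma S_measurable_past: "S m \<in> borel_measurable (past P X (Suc m))"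
  unfolding S_def[abs_def] by (intro borel_measurable_sum X_measurable_past) auto

lemma pair_measurable_seq:
  assumes "1 \<le> i"
  shows "(\<lambda>\<omega>. (X i \<omega>, Xe i \<omega>)) \<in> seq_algebra \<rightarrow>\<^sub>M borel \<Otimes>\<^sub>M borel"
proof -
  have "(\<lambda>\<omega>. \<lambda>i\<in>{1..}. (X i \<omega>, Xe i \<omega>)) \<in> seq_algebra \<rightarrow>\<^sub>M (\<Pi>\<^sub>M i\<in>{1..}. borel \<Otimes>\<^sub>M borel)"
    unfolding seq_algebra_def by (rule measurable_vimage_algebra1) (auto simp: space_PiM space_pair_measure)
  then have "(\<lambda>\<omega>. (\<lambda>i\<in>{1..}. (X i \<omega>, Xe i \<omega>)) i) \<in> seq_algebra \<rightarrow>\<^sub>M borel \<Otimes>\<^sub>M borel"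
    by (rule measurable_compose) (rule measurable_component_singleton, use assms in auto)
  then show ?thesis using assms by simp
qed

lemma X_measurable_seq [measurable]: "X (Suc i) \<in> borel_measurable seq_algebra"
  using measurable_compose[OF pair_measurable_seq measurable_fst, of "Suc i"] by simp

lemma Xe_measurable_seq [measurable]: "Xe (Suc i) \<in> borel_measurable seq_algebra"
  using measurable_compose[OF pair_measurable_seq measurable_snd, of "Suc i"] by simp

lemma S_measurable_seq [measurable]: "S m \<in> borel_measurable seq_algebra"
  unfolding S_def[abs_def] by measurable

lemma T_measurable_seq [measurable]: "T m \<in> borel_measurable seq_algebra"
  unfolding T_def[abs_def] by measurable

lemma measurable_seqD: "f \<in> seq_algebra \<rightarrow>\<^sub>M L \<Longrightarrow> f \<in> P \<rightarrow>\<^sub>M L"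
  by (rule measurable_from_subalg[OF subalgebra_seq])

lemma X_measurable [measurable]: "X (Suc i) \<in> borel_measurable P"
  and Xe_measurable [measurable]: "Xe (Suc i) \<in> borel_measurable P"
  and S_measurable [measurable]: "S m \<in> borel_measurable P"
  and T_measurable [measurable]: "T m \<in> borel_measurable P"
  by (rule measurable_seqD[OF X_measurable_seq] measurable_seqD[OF Xe_measurable_seq]
      measurable_seqD[OF S_measurable_seq] measurable_seqD[OF T_measurable_seq])+

lemma S_N_measurable [measurable]: "(\<lambda>\<omega>. S (N \<omega>) \<omega>) \<in> borel_measurable P"
  and S_M_measurable [measurable]: "(\<lambda>\<omega>. S (M \<omega>) \<omega>) \<in> borel_measurable P"
  and T_M_measurable [measurable]: "(\<lambda>\<omega>. T (M \<omega> - 1) \<omega>) \<in> borel_measurable P"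
  using measurable_compose_countable[of S P borel N] measurable_compose_countable[of S P borel M]
    measurable_compose_countable[of T P borel "\<lambda>\<omega>. M \<omega> - 1"] by measurable

section \<open>Mixing over the random indices\<close>

text \<open>Each event depends on the pair (N, M) alone and is independent of \<open>g i\<close>, so
  every term factors. The predicate \<open>Q\<close> is kept general to cover three cases: i + 1
  \<le> N for Wald sums, M = i + 1 for mixtures, and i between N and M for the difference of partial
  sums.\<close>

lemma nn_integral_random_index:
  assumes g: "\<And>i. g i \<in> borel_measurable seq_algebra"
  shows "(\<integral>\<^sup>+\<omega>. (\<Sum>i. indicator {\<omega> \<in> space P. Q i (N \<omega>) (M \<omega>)} \<omega> * g i \<omega>) \<partial>P)
    = (\<Sum>i. emeasure P {\<omega> \<in> space P. Q i (N \<omega>) (M \<omega>)} * (\<integral>\<^sup>+\<omega>. g i \<omega> \<partial>P))"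
proof -
  have [measurable]: "g i \<in> borel_measurable P" for i using g by (rule measurable_seqD)
  have [measurable]: "{\<omega> \<in> space P. Q i (N \<omega>) (M \<omega>)} \<in> sets P" for i
  proof -
    have "(\<lambda>\<omega>. (N \<omega>, M \<omega>)) \<in> P \<rightarrow>\<^sub>M count_space UNIV"
      by measurable
    then have "(\<lambda>\<omega>. case (N \<omega>, M \<omega>) of (n, m) \<Rightarrow> Q i n m) \<in> P \<rightarrow>\<^sub>M count_space UNIV"
      by (rule measurable_compose) simp
    then show ?thesis by simp
  qed
  have "{\<omega> \<in> space P. Q i (N \<omega>) (M \<omega>)}
      \<in> sets (vimage_algebra (space P) (\<lambda>\<omega>. (N \<omega>, M \<omega>)) (count_space UNIV))" for i
    using in_vimage_algebra[of "{(n, m). Q i n m}" "count_space UNIV" "\<lambda>\<omega>. (N \<omega>, M \<omega>)" "space P"]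
    by (simp add: vimage_def Int_def conj_commute)
  then have "(\<integral>\<^sup>+\<omega>. indicator {\<omega> \<in> space P. Q i (N \<omega>) (M \<omega>)} \<omega> * g i \<omega> \<partial>P)
      = emeasure P {\<omega> \<in> space P. Q i (N \<omega>) (M \<omega>)} * (\<integral>\<^sup>+\<omega>. g i \<omega> \<partial>P)" for i
    by (intro nn_integral_indep_set[OF subalgebra_seq indep[folded seq_algebra_def]] g)
  then show ?thesis by (subst nn_integral_suminf) auto
qed

lemma suminf_indicator_interval:
  fixes a :: "nat \<Rightarrow> ennreal"
  shows "(\<Sum>i. (if k \<le> i \<and> i < n then a i else 0)) = (\<Sum>i = k..<n. a i)"
  by (subst suminf_finite[of "{k..<n}"]) auto

lemma X_integrable: "integrable P (X (Suc i))"
  by (rule square_integrable_imp_integrable[OF X_measurable]) (rule X_sq, simp)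

lemma X_expectation: "expectation (X (Suc i)) = mu (Suc i)"
proof -
  interpret F: finite_measure_subalgebra P "past P X (Suc i)"
    by standard (rule subalgebra_past)
  have "expectation (X (Suc i)) = expectation (real_cond_exp P (past P X (Suc i)) (X (Suc i)))"
    by (rule F.real_cond_exp_int(2)[OF X_integrable, symmetric])
  also have "\<dots> = expectation (\<lambda>_. mu (Suc i))"
    by (rule integral_cong_AE[OF _ _ X_cond]) simp_all
  finally show ?thesis by (simp add: prob_space)
qed

lemma mu_nonneg: "0 \<le> mu (Suc i)"
  unfolding X_expectation[symmetric] using X_nonneg[of "Suc i"] by (intro integral_nonneg_AE) auto

lemma nn_integral_X: "(\<integral>\<^sup>+\<omega>. ennreal (X (Suc i) \<omega>) \<partial>P) = ennreal (mu (Suc i))"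
  using nn_integral_eq_integral[OF X_integrable X_nonneg, of i] by (simp add: X_expectation)

lemma AE_X_nonneg: "AE \<omega> in P. \<forall>i. 0 \<le> X (Suc i) \<omega>"
  by (rule AE_all_countable[THEN iffD2], intro allI X_nonneg) simp

lemma integrable_S_N: "integrable P (\<lambda>\<omega>. S (N \<omega>) \<omega>)"
  and expectation_S_N: "expectation (\<lambda>\<omega>. S (N \<omega>) \<omega>) = \<mu>"
  using mu_def unfolding sum_eq_S has_bochner_integral_iff by simp_all

lemma nn_integral_S_N: "(\<integral>\<^sup>+\<omega>. ennreal (S (N \<omega>) \<omega>) \<partial>P) = ennreal \<mu>"
proof -
  have "AE \<omega> in P. 0 \<le> S (N \<omega>) \<omega>"
    using AE_X_nonneg by eventually_elim (auto simp: S_def intro!: sum_nonneg)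
  then show ?thesis
    using nn_integral_eq_integral[OF integrable_S_N] expectation_S_N by simp
qed

text \<open>Wald's identity in nonnegative form: the summand with index i is present exactly when N
  \<ge> i + 1.\<close>

lemma nn_integral_telescope_N:
  assumes g: "\<And>i. g i \<in> borel_measurable seq_algebra"
  shows "(\<integral>\<^sup>+\<omega>. (\<Sum>i<N \<omega>. g i \<omega>) \<partial>P)
    = (\<Sum>i. emeasure P {\<omega> \<in> space P. Suc i \<le> N \<omega>} * (\<integral>\<^sup>+\<omega>. g i \<omega> \<partial>P))"
proof -
  have "(\<Sum>i<N \<omega>. g i \<omega>) = (\<Sum>i. indicator {\<omega> \<in> space P. Suc i \<le> N \<omega>} \<omega> * g i \<omega>)"
    if "\<omega> \<in> space P" for \<omega>
    using that by (subst suminf_finite[of "{..<N \<omega>}"]) (auto split: split_indicator)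
  then have "(\<integral>\<^sup>+\<omega>. (\<Sum>i<N \<omega>. g i \<omega>) \<partial>P)
      = (\<integral>\<^sup>+\<omega>. (\<Sum>i. indicator {\<omega> \<in> space P. Suc i \<le> N \<omega>} \<omega> * g i \<omega>) \<partial>P)"
    by (intro nn_integral_cong) simp
  then show ?thesis
    using nn_integral_random_index[OF g, of "\<lambda>i n m. Suc i \<le> n"] by simp
qed

lemma mean_series: "(\<Sum>i. ennreal (mu (Suc i) * prob {\<omega> \<in> space P. Suc i \<le> N \<omega>})) = ennreal \<mu>"
proof -
  have "ennreal \<mu> = (\<integral>\<^sup>+\<omega>. (\<Sum>i<N \<omega>. ennreal (X (Suc i) \<omega>)) \<partial>P)"
    unfolding nn_integral_S_N[symmetric]
    by (rule nn_integral_cong_AE, use AE_X_nonneg in eventually_elim) (auto simp: S_def sum_ennreal)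
  also have "\<dots> = (\<Sum>i. emeasure P {\<omega> \<in> space P. Suc i \<le> N \<omega>} * ennreal (mu (Suc i)))"
    by (subst nn_integral_telescope_N) (auto simp: nn_integral_X)
  also have "\<dots> = (\<Sum>i. ennreal (mu (Suc i) * prob {\<omega> \<in> space P. Suc i \<le> N \<omega>}))"
    using mu_nonneg by (simp add: emeasure_eq_measure ennreal_mult' mult.commute)
  finally show ?thesis by simp
qed

lemma mean_sums: "(\<lambda>i. mu (Suc i) * prob {\<omega> \<in> space P. Suc i \<le> N \<omega>}) sums \<mu>"
proof -
  have "summable (\<lambda>i. mu (Suc i) * prob {\<omega> \<in> space P. Suc i \<le> N \<omega>})"
    using mean_series mu_nonneg by (intro summable_suminf_not_top) auto
  moreover have "(\<Sum>i. mu (Suc i) * prob {\<omega> \<in> space P. Suc i \<le> N \<omega>}) = \<mu>"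
    using mean_series mu_nonneg mu_pos suminf_nonneg[OF calculation]
    by (subst (asm) suminf_ennreal2) (auto simp: calculation)
  ultimately show ?thesis by (simp add: sums_iff)
qed

lemma emeasure_M_Suc:
  "emeasure P {\<omega> \<in> space P. M \<omega> = Suc i}
    = ennreal (inverse \<mu>) * ennreal (mu (Suc i) * prob {\<omega> \<in> space P. Suc i \<le> N \<omega>})"
proof -
  have "emeasure P {\<omega> \<in> space P. M \<omega> = Suc i}
      = ennreal (inverse \<mu> * (mu (Suc i) * prob {\<omega> \<in> space P. Suc i \<le> N \<omega>}))"
    unfolding emeasure_eq_measure using M_law[of "Suc i"] by (simp add: divide_inverse mult.commute)
  also have "\<dots> = ennreal (inverse \<mu>) * ennreal (mu (Suc i) * prob {\<omega> \<in> space P. Suc i \<le> N \<omega>})"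
    using mu_pos by (intro ennreal_mult') simp
  finally show ?thesis .
qed

text \<open>The law of \<open>M\<close> is prescribed for m \<ge> 1 only. By
  \<open>mean_series\<close> these masses already add up to 1, which leaves nothing for M =
  0.\<close>

lemma AE_M_pos: "AE \<omega> in P. 1 \<le> M \<omega>"
proof -
  have "emeasure P {\<omega> \<in> space P. 1 \<le> M \<omega>} = emeasure P (\<Union>i. {\<omega> \<in> space P. M \<omega> = Suc i})"
    by (intro arg_cong[where f = "emeasure P"]) (auto simp: Suc_le_eq gr0_conv_Suc)
  also have "\<dots> = (\<Sum>i. emeasure P {\<omega> \<in> space P. M \<omega> = Suc i})"
    by (rule suminf_emeasure[symmetric]) (auto simp: disjoint_family_on_def)
  also have "\<dots> = ennreal (inverse \<mu>) * ennreal \<mu>"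
    unfolding emeasure_M_Suc by (simp add: mean_series)
  also have "\<dots> = 1"
    using mu_pos by (simp flip: ennreal_mult' ennreal_1)
  finally have "prob {\<omega> \<in> space P. 1 \<le> M \<omega>} = 1"
    by (simp add: emeasure_eq_measure)
  then show ?thesis
    by (subst (asm) prob_eq_1) auto
qed

lemma nn_integral_at_M:
  assumes g: "\<And>i. g i \<in> borel_measurable seq_algebra"
  shows "(\<integral>\<^sup>+\<omega>. g (M \<omega> - 1) \<omega> \<partial>P)
    = (\<Sum>i. emeasure P {\<omega> \<in> space P. M \<omega> = Suc i} * (\<integral>\<^sup>+\<omega>. g i \<omega> \<partial>P))"
proof -
  have *: "g (M \<omega> - 1) \<omega> = (\<Sum>i. indicator {\<omega> \<in> space P. M \<omega> = Suc i} \<omega> * g i \<omega>)"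
    if M: "1 \<le> M \<omega>" and \<omega>: "\<omega> \<in> space P" for \<omega>
  proof -
    obtain m where m: "M \<omega> = Suc m" using M not0_implies_Suc[of "M \<omega>"] by fastforce
    have "(\<Sum>i. indicator {\<omega> \<in> space P. M \<omega> = Suc i} \<omega> * g i \<omega>)
        = (\<Sum>i\<in>{m}. indicator {\<omega> \<in> space P. M \<omega> = Suc i} \<omega> * g i \<omega>)"
      by (rule suminf_finite) (simp_all add: m)
    then show ?thesis using \<omega> by (simp add: m)
  qed
  have "AE \<omega> in P. g (M \<omega> - 1) \<omega> = (\<Sum>i. indicator {\<omega> \<in> space P. M \<omega> = Suc i} \<omega> * g i \<omega>)"
    using AE_M_pos AE_space[of P] by eventually_elim (rule *)
  then have "(\<integral>\<^sup>+\<omega>. g (M \<omega> - 1) \<omega> \<partial>P)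
      = (\<integral>\<^sup>+\<omega>. (\<Sum>i. indicator {\<omega> \<in> space P. M \<omega> = Suc i} \<omega> * g i \<omega>) \<partial>P)"
    by (rule nn_integral_cong_AE)
  then show ?thesis
    using nn_integral_random_index[OF g, of "\<lambda>i n m. m = Suc i"] by simp
qed

section \<open>Conditional laws of a single summand\<close>

lemmas \<kappa>_law = X_law[of "Suc m" for m, simplified] and \<kappa>e_law = Xe_law[of "Suc m" for m, simplified]

lemma real_distribution_\<kappa>: "\<omega> \<in> space P \<Longrightarrow> real_distribution (\<kappa> (Suc m) \<omega>)"
  by (rule regular_cond_law_real_distribution[OF \<kappa>_law subalgebra_past])

lemma real_distribution_\<kappa>e: "\<omega> \<in> space P \<Longrightarrow> real_distribution (\<kappa>e (Suc m) \<omega>)"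
  by (rule regular_cond_law_real_distribution[OF \<kappa>e_law subalgebra_past])

lemma \<kappa>_measurable [measurable]: "\<kappa> (Suc m) \<in> past P X (Suc m) \<rightarrow>\<^sub>M subprob_algebra borel"
  using \<kappa>_law[of m] by (auto simp: regular_cond_law_def intro: measurable_prob_algebraD)

lemma AE_\<kappa>_nonneg: "AE \<omega> in P. AE y in \<kappa> (Suc m) \<omega>. 0 \<le> y"
proof -
  have "(\<integral>\<^sup>+\<omega>. \<integral>\<^sup>+y. indicator {..<0} y \<partial>\<kappa> (Suc m) \<omega> \<partial>P) = (\<integral>\<^sup>+\<omega>. indicator {..<0} (X (Suc m) \<omega>) \<partial>P)"
    by (rule nn_integral_regular_cond_law[OF subalgebra_past _ \<kappa>_law, symmetric]) measurable
  also have "\<dots> = (\<integral>\<^sup>+\<omega>. 0 \<partial>P)"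
    by (rule nn_integral_cong_AE, use X_nonneg[of "Suc m"] in auto)
  finally have "(\<integral>\<^sup>+\<omega>. \<integral>\<^sup>+y. indicator {..<0} y \<partial>\<kappa> (Suc m) \<omega> \<partial>P) = 0" by simp
  moreover have "(\<lambda>\<omega>. \<integral>\<^sup>+y. indicator {..<0::real} y \<partial>\<kappa> (Suc m) \<omega>) \<in> borel_measurable P"
    by (rule measurable_from_subalg[OF subalgebra_past, of _ "Suc m"],
        rule nn_integral_measurable_subprob_algebra2[where N = borel]) measurable
  ultimately have "AE \<omega> in P. (\<integral>\<^sup>+y. indicator {..<0} y \<partial>\<kappa> (Suc m) \<omega>) = 0"
    by (subst (asm) nn_integral_0_iff_AE)
  then show ?thesis
    using AE_space[of P]
  proof eventually_elim
    case (elim \<omega>)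
    interpret k: real_distribution "\<kappa> (Suc m) \<omega>" by (rule real_distribution_\<kappa>[OF elim(2)])
    have "AE y in \<kappa> (Suc m) \<omega>. indicator {..<0} y = (0::ennreal)"
      using elim(1) by (subst (asm) nn_integral_0_iff_AE) auto
    then show ?case by eventually_elim (auto split: split_indicator_asm)
  qed
qed

text \<open>\<open>X_cond\<close> speaks of a conditional expectation,
  \<open>equilibrium_law\<close> of the mean of the kernel. Both the kernel mean and the constant
  \<open>mu (Suc m)\<close> satisfy the characterisation of the nonnegative conditional expectation,
  so they agree almost surely.\<close>

lemma AE_\<kappa>_mean: "AE \<omega> in P. (\<integral>\<^sup>+y. ennreal y \<partial>\<kappa> (Suc m) \<omega>) = ennreal (mu (Suc m))"
proof -
  let ?F = "past P X (Suc m)"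
  interpret F: finite_measure_subalgebra P ?F by standard (rule subalgebra_past)
  have sub: "A \<in> sets P" if "A \<in> sets ?F" for A
    using that subalgebra_past by (auto simp: subalgebra_def)
  have "AE \<omega> in P. (\<integral>\<^sup>+y. ennreal y \<partial>\<kappa> (Suc m) \<omega>) = nn_cond_exp P ?F (\<lambda>\<omega>. ennreal (X (Suc m) \<omega>)) \<omega>"
  proof (rule F.nn_cond_exp_charact)
    fix A assume A [measurable]: "A \<in> sets ?F"
    have "(\<integral>\<^sup>+\<omega>\<in>A. ennreal (X (Suc m) \<omega>) \<partial>P) = (\<integral>\<^sup>+\<omega>. \<integral>\<^sup>+y. ennreal y * indicator A \<omega> \<partial>\<kappa> (Suc m) \<omega> \<partial>P)"
      by (rule nn_integral_regular_cond_law[OF subalgebra_past _ \<kappa>_law]) measurable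
    also have "\<dots> = (\<integral>\<^sup>+\<omega>\<in>A. (\<integral>\<^sup>+y. ennreal y \<partial>\<kappa> (Suc m) \<omega>) \<partial>P)"
    proof (rule nn_integral_cong)
      fix \<omega> assume w: "\<omega> \<in> space P"
      interpret k: real_distribution "\<kappa> (Suc m) \<omega>" by (rule real_distribution_\<kappa>[OF w])
      show "(\<integral>\<^sup>+y. ennreal y * indicator A \<omega> \<partial>\<kappa> (Suc m) \<omega>) = (\<integral>\<^sup>+y. ennreal y \<partial>\<kappa> (Suc m) \<omega>) * indicator A \<omega>"
        by (rule nn_integral_multc) simp
    qed
    finally show "(\<integral>\<^sup>+\<omega>\<in>A. ennreal (X (Suc m) \<omega>) \<partial>P) = (\<integral>\<^sup>+\<omega>\<in>A. (\<integral>\<^sup>+y. ennreal y \<partial>\<kappa> (Suc m) \<omega>) \<partial>P)" .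
  next
    show "(\<lambda>\<omega>. \<integral>\<^sup>+y. ennreal y \<partial>\<kappa> (Suc m) \<omega>) \<in> borel_measurable ?F"
      by (rule nn_integral_measurable_subprob_algebra2[where N = borel]) measurable
  qed measurable
  moreover have "AE \<omega> in P. ennreal (mu (Suc m)) = nn_cond_exp P ?F (\<lambda>\<omega>. ennreal (X (Suc m) \<omega>)) \<omega>"
  proof (rule F.nn_cond_exp_charact)
    fix A assume A: "A \<in> sets ?F"
    have [measurable]: "A \<in> sets P" using A by (rule sub)
    have "(\<integral>\<^sup>+\<omega>\<in>A. ennreal (X (Suc m) \<omega>) \<partial>P) = (\<integral>\<^sup>+\<omega>. ennreal (indicator A \<omega> * X (Suc m) \<omega>) \<partial>P)"
      by (rule nn_integral_cong) (auto split: split_indicator)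
    also have "\<dots> = ennreal (\<integral>\<omega>. indicator A \<omega> * X (Suc m) \<omega> \<partial>P)"
    proof (rule nn_integral_eq_integral)
      show "integrable P (\<lambda>\<omega>. indicator A \<omega> * X (Suc m) \<omega>)"
        using integrable_mult_indicator[OF _ X_integrable] by simp
      show "AE \<omega> in P. 0 \<le> indicator A \<omega> * X (Suc m) \<omega>"
        by (rule eventually_mono[OF X_nonneg[of "Suc m"]]) simp_all
    qed
    also have "(\<integral>\<omega>. indicator A \<omega> * X (Suc m) \<omega> \<partial>P) = (\<integral>\<omega>\<in>A. real_cond_exp P ?F (X (Suc m)) \<omega> \<partial>P)"
      using F.real_cond_exp_intA[OF X_integrable A] by (simp add: set_lebesgue_integral_def)
    also have "\<dots> = (\<integral>\<omega>. indicator A \<omega> * mu (Suc m) \<partial>P)"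
      unfolding set_lebesgue_integral_def
      by (rule integral_cong_AE) (use X_cond[of "Suc m"] in auto)
    also have "\<dots> = mu (Suc m) * prob A" by simp
    also have "ennreal (mu (Suc m) * prob A) = (\<integral>\<^sup>+\<omega>\<in>A. ennreal (mu (Suc m)) \<partial>P)"
      by (simp add: nn_integral_cmult emeasure_eq_measure ennreal_mult' mu_nonneg)
    finally show "(\<integral>\<^sup>+\<omega>\<in>A. ennreal (X (Suc m) \<omega>) \<partial>P) = (\<integral>\<^sup>+\<omega>\<in>A. ennreal (mu (Suc m)) \<partial>P)" .
  qed measurable
  ultimately show ?thesis by eventually_elim simp
qed

section \<open>The equilibrium coupling of the random sum\<close>

text \<open>Given the past, \<open>S m\<close> is a constant s, and the equilibrium identity applies
  to y \<mapsto> g (s + y). The kernel mean it produces is the constant \<open>mu (Suc m)\<close>,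
  which therefore leaves the outer integral.\<close>

lemma nn_integral_increment:
  fixes g g' :: "real \<Rightarrow> real"
  assumes D: "\<And>x. (g has_real_derivative g' x) (at x)" and cont: "continuous_on UNIV g'"
    and bd: "\<And>x. 0 \<le> g' x" "\<And>x. g' x \<le> L"
  shows "(\<integral>\<^sup>+\<omega>. ennreal (g (S (Suc m) \<omega>) - g (S m \<omega>)) \<partial>P)
    = ennreal (mu (Suc m)) * (\<integral>\<^sup>+\<omega>. ennreal (g' (T m \<omega>)) \<partial>P)"
proof -
  let ?F = "past P X (Suc m)"
  have lip: "L-lipschitz_on UNIV g" using D bd by (intro lipschitz_of_deriv_bound) auto
  have [measurable]: "g \<in> borel_measurable borel" "g' \<in> borel_measurable borel"
    using borel_measurable_lipschitz[OF lip] borel_measurable_continuous_onI[OF cont] by auto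
  have [measurable]: "S m \<in> borel_measurable ?F" by (rule S_measurable_past)
  have mono: "g x \<le> g y" if "x \<le> y" for x y
    using that D bd(1) by (intro DERIV_nonneg_imp_nondecreasing[of x y g]) auto
  have "(\<integral>\<^sup>+\<omega>. ennreal (g (S (Suc m) \<omega>) - g (S m \<omega>)) \<partial>P)
      = (\<integral>\<^sup>+\<omega>. ennreal (g (S m \<omega> + X (Suc m) \<omega>) - g (S m \<omega>)) \<partial>P)"
    by (simp add: S_def)
  also have "\<dots> = (\<integral>\<^sup>+\<omega>. \<integral>\<^sup>+y. ennreal (g (S m \<omega> + y) - g (S m \<omega>)) \<partial>\<kappa> (Suc m) \<omega> \<partial>P)"
    by (rule nn_integral_regular_cond_law[OF subalgebra_past _ \<kappa>_law]) measurable
  also have "\<dots> = (\<integral>\<^sup>+\<omega>. \<integral>\<^sup>+y. ennreal (mu (Suc m)) * ennreal (g' (S m \<omega> + y)) \<partial>\<kappa>e (Suc m) \<omega> \<partial>P)"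
  proof (rule nn_integral_cong_AE)
    have "AE \<omega> in P. equilibrium_law (\<kappa> (Suc m) \<omega>) (\<kappa>e (Suc m) \<omega>)"
      by (rule Xe_equilibrium) simp
    with AE_\<kappa>_nonneg[of m] AE_\<kappa>_mean[of m] AE_space[of P]
    show "AE \<omega> in P. (\<integral>\<^sup>+y. ennreal (g (S m \<omega> + y) - g (S m \<omega>)) \<partial>\<kappa> (Suc m) \<omega>)
        = (\<integral>\<^sup>+y. ennreal (mu (Suc m)) * ennreal (g' (S m \<omega> + y)) \<partial>\<kappa>e (Suc m) \<omega>)"
    proof eventually_elim
      case (elim \<omega>)
      let ?k = "\<kappa> (Suc m) \<omega>" and ?ke = "\<kappa>e (Suc m) \<omega>" and ?s = "S m \<omega>"
      interpret k: real_distribution ?k by (rule real_distribution_\<kappa>[OF elim(3)])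
      interpret ke: real_distribution ?ke by (rule real_distribution_\<kappa>e[OF elim(3)])
      have int_id: "integrable ?k (\<lambda>y. y)"
        using elim(1,2) by (intro integrableI_nonneg) auto
      have mean: "(\<integral>y. y \<partial>?k) = mu (Suc m)"
        using nn_integral_eq_integral[OF int_id elim(1)] elim(2) mu_nonneg integral_nonneg_AE[OF elim(1)]
        by simp
      define f where "f y = g (?s + y)" for y
      have f_lip: "L-lipschitz_on UNIV f"
        using lipschitz_onD[OF lip] lipschitz_on_nonneg[OF lip]
        by (intro lipschitz_onI) (auto simp: f_def dist_real_def, metis UNIV_I add_diff_cancel_left dist_real_def)
      \<comment> \<open>\<open>f\<close> is differentiable everywhere, so \<open>deriv\<close> never
        takes an unspecified value.\<close>
      have f_deriv: "deriv f y = g' (?s + y)" for y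
        unfolding f_def using D[of "?s + y"] by (intro DERIV_imp_deriv) (simp add: DERIV_shift add.commute)
      have int_f: "integrable ?k f" by (rule k.integrable_lipschitz[OF f_lip int_id])
      have int_g': "integrable ?ke (\<lambda>y. g' (?s + y))"
        using bd by (intro ke.integrable_const_bound[where B = L]) auto
      have "(\<integral>\<^sup>+y. ennreal (g (?s + y) - g ?s) \<partial>?k) = (\<integral>\<^sup>+y. ennreal (f y - f 0) \<partial>?k)"
        by (simp add: f_def)
      also have "\<dots> = ennreal (\<integral>y. f y - f 0 \<partial>?k)"
      proof (rule nn_integral_eq_integral)
        show "integrable ?k (\<lambda>y. f y - f 0)" using int_f by simp
        show "AE y in ?k. 0 \<le> f y - f 0"
          using elim(1) by eventually_elim (auto simp: f_def intro!: mono)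
      qed
      also have "(\<integral>y. f y - f 0 \<partial>?k) = (\<integral>y. f y \<partial>?k) - f 0"
        using int_f k.prob_space by simp
      also have "\<dots> = (\<integral>y. y \<partial>?k) * (\<integral>y. deriv f y \<partial>?ke)"
        using elim(4) f_lip unfolding equilibrium_law_def by blast
      also have "\<dots> = mu (Suc m) * (\<integral>y. g' (?s + y) \<partial>?ke)"
        by (simp add: mean f_deriv)
      also have "ennreal \<dots> = ennreal (mu (Suc m)) * ennreal (\<integral>y. g' (?s + y) \<partial>?ke)"
        using mu_nonneg by (rule ennreal_mult')
      also have "ennreal (\<integral>y. g' (?s + y) \<partial>?ke) = (\<integral>\<^sup>+y. ennreal (g' (?s + y)) \<partial>?ke)"
        using int_g' bd(1) by (intro nn_integral_eq_integral[symmetric]) auto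
      also have "ennreal (mu (Suc m)) * \<dots> = (\<integral>\<^sup>+y. ennreal (mu (Suc m)) * ennreal (g' (?s + y)) \<partial>?ke)"
        by (intro nn_integral_cmult[symmetric]) simp
      finally show ?case .
    qed
  qed
  \<comment> \<open>The disintegration is read backwards, now with the kernel of
    \<open>Xe (Suc m)\<close> given the same past.\<close>
  also have "\<dots> = (\<integral>\<^sup>+\<omega>. ennreal (mu (Suc m)) * ennreal (g' (S m \<omega> + Xe (Suc m) \<omega>)) \<partial>P)"
    by (rule nn_integral_regular_cond_law[OF subalgebra_past _ \<kappa>e_law, symmetric]) measurable
  also have "\<dots> = ennreal (mu (Suc m)) * (\<integral>\<^sup>+\<omega>. ennreal (g' (T m \<omega>)) \<partial>P)"
    unfolding T_def by (rule nn_integral_cmult) measurable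
  finally show ?thesis .
qed

text \<open>Telescoping up to N gives increment i + 1 the weight P(N \<ge> i + 1), and
  \<open>nn_integral_increment\<close> adds the factor \<open>mu (Suc i)\<close>. The product is
  \<mu> P(M = i + 1), so the series is an expectation at the random index \<open>M\<close>.\<close>

lemma nn_integral_equilibrium:
  fixes g g' :: "real \<Rightarrow> real"
  assumes D: "\<And>x. (g has_real_derivative g' x) (at x)" and cont: "continuous_on UNIV g'"
    and bd: "\<And>x. 0 \<le> g' x" "\<And>x. g' x \<le> L"
  shows "(\<integral>\<^sup>+\<omega>. ennreal (g (S (N \<omega>) \<omega>) - g 0) \<partial>P)
    = ennreal \<mu> * (\<integral>\<^sup>+\<omega>. ennreal (g' (T (M \<omega> - 1) \<omega>)) \<partial>P)"
proof -
  have [measurable]: "g' \<in> borel_measurable borel"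
    using borel_measurable_continuous_onI[OF cont] .
  have [measurable]: "g \<in> borel_measurable borel"
    using D by (intro borel_measurable_continuous_onI) (auto simp: continuous_on_eq_continuous_at intro: DERIV_isCont)
  have mono: "g x \<le> g y" if "x \<le> y" for x y
    using that D bd(1) by (intro DERIV_nonneg_imp_nondecreasing[of x y g]) auto
  have "(\<integral>\<^sup>+\<omega>. ennreal (g (S (N \<omega>) \<omega>) - g 0) \<partial>P)
      = (\<integral>\<^sup>+\<omega>. (\<Sum>i<N \<omega>. ennreal (g (S (Suc i) \<omega>) - g (S i \<omega>))) \<partial>P)"
  proof (rule nn_integral_cong_AE)
    show "AE \<omega> in P. ennreal (g (S (N \<omega>) \<omega>) - g 0) = (\<Sum>i<N \<omega>. ennreal (g (S (Suc i) \<omega>) - g (S i \<omega>)))"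
      using AE_X_nonneg
    proof eventually_elim
      case (elim \<omega>)
      have "g (S i \<omega>) \<le> g (S (Suc i) \<omega>)" for i
        using elim by (intro mono) (simp add: S_def)
      then have "(\<Sum>i<N \<omega>. ennreal (g (S (Suc i) \<omega>) - g (S i \<omega>)))
          = ennreal (\<Sum>i<N \<omega>. g (S (Suc i) \<omega>) - g (S i \<omega>))"
        by (intro sum_ennreal) simp
      also have "(\<Sum>i<N \<omega>. g (S (Suc i) \<omega>) - g (S i \<omega>)) = g (S (N \<omega>) \<omega>) - g (S 0 \<omega>)"
        by (rule sum_lessThan_telescope)
      finally show ?case by (simp add: S_def)
    qed
  qed
  also have "\<dots> = (\<Sum>i. emeasure P {\<omega> \<in> space P. Suc i \<le> N \<omega>} *
      (\<integral>\<^sup>+\<omega>. ennreal (g (S (Suc i) \<omega>) - g (S i \<omega>)) \<partial>P))"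
    by (rule nn_integral_telescope_N) measurable
  also have "\<dots> = (\<Sum>i. ennreal \<mu> * (emeasure P {\<omega> \<in> space P. M \<omega> = Suc i} * (\<integral>\<^sup>+\<omega>. ennreal (g' (T i \<omega>)) \<partial>P)))"
  proof (rule suminf_cong)
    fix i
    have "ennreal \<mu> * emeasure P {\<omega> \<in> space P. M \<omega> = Suc i}
        = ennreal (mu (Suc i) * prob {\<omega> \<in> space P. Suc i \<le> N \<omega>})"
      unfolding emeasure_M_Suc mult.assoc[symmetric] using mu_pos
      by (simp flip: ennreal_mult')
    also have "\<dots> = ennreal (mu (Suc i)) * emeasure P {\<omega> \<in> space P. Suc i \<le> N \<omega>}"
      unfolding emeasure_eq_measure using mu_nonneg by (rule ennreal_mult')
    finally show "emeasure P {\<omega> \<in> space P. Suc i \<le> N \<omega>} * (\<integral>\<^sup>+\<omega>. ennreal (g (S (Suc i) \<omega>) - g (S i \<omega>)) \<partial>P)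
      = ennreal \<mu> * (emeasure P {\<omega> \<in> space P. M \<omega> = Suc i} * (\<integral>\<^sup>+\<omega>. ennreal (g' (T i \<omega>)) \<partial>P))"
      unfolding nn_integral_increment[OF D cont bd] mult.assoc[symmetric] by (simp add: mult.commute)
  qed
  also have "\<dots> = ennreal \<mu> * (\<integral>\<^sup>+\<omega>. ennreal (g' (T (M \<omega> - 1) \<omega>)) \<partial>P)"
    by (subst nn_integral_at_M) auto
  finally show ?thesis .
qed

definition W :: "'a \<Rightarrow> real" where
  "W \<omega> = inverse \<mu> * S (N \<omega>) \<omega>"

definition We :: "'a \<Rightarrow> real" where
  "We \<omega> = inverse \<mu> * T (M \<omega> - 1) \<omega>"

lemma We_measurable [measurable]: "We \<in> borel_measurable P"
  unfolding We_def[abs_def] by measurable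

lemma W_measurable [measurable]: "W \<in> borel_measurable P"
  unfolding W_def[abs_def] by measurable

lemma integrable_W: "integrable P W"
  unfolding W_def[abs_def] by (intro integrable_mult_right integrable_S_N)

lemma expectation_W: "expectation W = 1"
  unfolding W_def[abs_def] using expectation_S_N mu_pos by simp

lemma AE_W_nonneg: "AE \<omega> in P. 0 \<le> W \<omega>"
  using AE_X_nonneg
  by eventually_elim (use mu_pos in \<open>auto simp: W_def S_def intro!: mult_nonneg_nonneg sum_nonneg\<close>)

text \<open>Adding the identity to \<open>f\<close> makes the derivative nonnegative.\<close>

lemma We_equilibrium:
  fixes f f' :: "real \<Rightarrow> real"
  assumes D: "\<And>x. (f has_real_derivative f' x) (at x)" and cont: "continuous_on UNIV f'"
    and bd: "\<And>x. \<bar>f' x\<bar> \<le> 1"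
  shows "expectation (\<lambda>\<omega>. f (W \<omega>)) - f 0 = expectation (\<lambda>\<omega>. f' (We \<omega>))"
proof -
  \<comment> \<open>Division by \<mu> passes from \<open>W\<close> to the unscaled sum; the added
    identity has the same scale, so g' lies between 0 and 2 / \<mu>.\<close>
  define g where "g s = f (s / \<mu>) + s / \<mu>" for s
  define g' where "g' s = (f' (s / \<mu>) + 1) / \<mu>" for s
  have bd': "-1 \<le> f' x" "f' x \<le> 1" for x using bd[of x] by auto
  have gD: "(g has_real_derivative g' s) (at s)" for s
  proof -
    have "((\<lambda>s. f (s / \<mu>)) has_real_derivative f' (s / \<mu>) * (1 / \<mu>)) (at s)"
      by (rule DERIV_chain2[OF D]) (intro DERIV_cdivide DERIV_ident)
    from DERIV_add[OF this DERIV_cdivide[OF DERIV_ident]] show ?thesis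
      unfolding g_def g'_def by (simp add: add_divide_distrib)
  qed
  have g'_cont: "continuous_on UNIV g'"
    unfolding g'_def[abs_def]
    by (intro continuous_intros continuous_on_compose2[OF cont]) (use mu_pos in auto)
  have g'_bd: "0 \<le> g' s" "g' s \<le> 2 / \<mu>" for s
    unfolding g'_def using bd'[of "s / \<mu>"] mu_pos by (auto intro!: divide_right_mono)
  have mono: "g x \<le> g y" if "x \<le> y" for x y
    using that gD g'_bd(1) by (intro DERIV_nonneg_imp_nondecreasing[of x y g]) auto
  have [measurable]: "f' \<in> borel_measurable borel"
    using cont by (rule borel_measurable_continuous_onI)
  have f_int: "integrable P (\<lambda>\<omega>. f (W \<omega>))"
    by (rule integrable_lipschitz[OF lipschitz_of_deriv_bound[OF D bd] integrable_W])
  have f'_int: "integrable P (\<lambda>\<omega>. f' (We \<omega>))"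
    using bd by (intro integrable_const_bound[where B = 1]) auto
  have lhs: "g (S (N \<omega>) \<omega>) - g 0 = f (W \<omega>) + W \<omega> - f 0" for \<omega>
    by (simp add: g_def W_def divide_inverse mult.commute)
  have rhs: "g' (T (M \<omega> - 1) \<omega>) = inverse \<mu> * (f' (We \<omega>) + 1)" for \<omega>
    by (simp add: g'_def We_def divide_inverse mult.commute)
  have lhs_nonneg: "AE \<omega> in P. 0 \<le> f (W \<omega>) + W \<omega> - f 0"
    using AE_W_nonneg
  proof eventually_elim
    case (elim \<omega>)
    then have "0 \<le> S (N \<omega>) \<omega>" using mu_pos by (simp add: W_def zero_le_mult_iff)
    then show ?case using mono[of 0] unfolding lhs[symmetric] by simp
  qed
  have lhs_int: "integrable P (\<lambda>\<omega>. f (W \<omega>) + W \<omega> - f 0)"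
    using f_int integrable_W by auto
  have rhs_int: "integrable P (\<lambda>\<omega>. inverse \<mu> * (f' (We \<omega>) + 1))"
    using f'_int by auto
  have rhs_nonneg: "0 \<le> inverse \<mu> * (f' (We \<omega>) + 1)" for \<omega>
    using mu_pos bd'(1)[of "We \<omega>"] by simp
  have "ennreal (expectation (\<lambda>\<omega>. f (W \<omega>) + W \<omega> - f 0))
      = (\<integral>\<^sup>+\<omega>. ennreal (g (S (N \<omega>) \<omega>) - g 0) \<partial>P)"
    unfolding lhs by (rule nn_integral_eq_integral[symmetric, OF lhs_int lhs_nonneg])
  also have "\<dots> = ennreal \<mu> * (\<integral>\<^sup>+\<omega>. ennreal (g' (T (M \<omega> - 1) \<omega>)) \<partial>P)"
    by (rule nn_integral_equilibrium[OF gD g'_cont g'_bd])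
  also have "(\<integral>\<^sup>+\<omega>. ennreal (g' (T (M \<omega> - 1) \<omega>)) \<partial>P) = ennreal (expectation (\<lambda>\<omega>. inverse \<mu> * (f' (We \<omega>) + 1)))"
    unfolding rhs by (rule nn_integral_eq_integral[OF rhs_int]) (use rhs_nonneg in auto)
  also have "ennreal \<mu> * \<dots> = ennreal (\<mu> * expectation (\<lambda>\<omega>. inverse \<mu> * (f' (We \<omega>) + 1)))"
    using mu_pos by (simp add: ennreal_mult')
  finally have "expectation (\<lambda>\<omega>. f (W \<omega>) + W \<omega> - f 0) = \<mu> * expectation (\<lambda>\<omega>. inverse \<mu> * (f' (We \<omega>) + 1))"
    using mu_pos rhs_nonneg integral_nonneg_AE[OF lhs_nonneg]
    by (subst (asm) ennreal_inj) (simp_all only: mult_nonneg_nonneg integral_nonneg_AE AE_I2 less_imp_le)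
  also have "\<dots> = expectation (\<lambda>\<omega>. f' (We \<omega>)) + 1"
    using mu_pos f'_int by (simp add: prob_space)
  \<comment> \<open>The added identity contributes E W = 1 on the left and the constant 1 on the
    right, and these cancel.\<close>
  finally show ?thesis
    using f_int integrable_W expectation_W by (simp add: prob_space)
qed

section \<open>Wasserstein bound for the random sum\<close>

lemma abs_S_diff_le:
  assumes "\<And>i. 0 \<le> X (Suc i) \<omega>"
  shows "\<bar>S n \<omega> - S m \<omega>\<bar> \<le> (\<Sum>i = min n m..<max n m. X (Suc i) \<omega>)"
proof -
  have *: "S n \<omega> - S m \<omega> = (\<Sum>i = m..<n. X (Suc i) \<omega>)" if "m \<le> n" for n m
    using sum_diff_nat_ivl[of 0 m n "\<lambda>i. X (Suc i) \<omega>"] that by (simp add: S_def atLeast0LessThan)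
  show ?thesis
    using *[of m n] *[of n m] assms
    by (cases "m \<le> n") (auto simp: sum_nonneg abs_minus_commute)
qed

text \<open>Wald's argument over the random interval between N and M: the event that i lies in it is
  independent of the summand \<open>X (Suc i)\<close>, whose mean is at most the supremum, and the
  expected number of such i is E|N - M|. Either factor may be infinite.\<close>

lemma nn_integral_S_diff:
  "(\<integral>\<^sup>+\<omega>. ennreal \<bar>S (N \<omega>) \<omega> - S (M \<omega>) \<omega>\<bar> \<partial>P)
    \<le> (SUP i\<in>{1..}. ennreal (mu i)) * (\<integral>\<^sup>+\<omega>. ennreal \<bar>real (N \<omega>) - real (M \<omega>)\<bar> \<partial>P)"
proof -
  let ?A = "\<lambda>i. {\<omega> \<in> space P. min (N \<omega>) (M \<omega>) \<le> i \<and> i < max (N \<omega>) (M \<omega>)}"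
  have ind: "(\<Sum>i. indicator (?A i) \<omega> * a i) = (\<Sum>i = min (N \<omega>) (M \<omega>)..<max (N \<omega>) (M \<omega>). a i)"
    if "\<omega> \<in> space P" for \<omega> and a :: "nat \<Rightarrow> ennreal"
    unfolding suminf_indicator_interval[symmetric]
    using that by (intro suminf_cong) (auto split: split_indicator)
  have card: "ennreal \<bar>real n - real m\<bar> = (\<Sum>i = min n m..<max n m. 1)" for n m :: nat
    by (cases "n \<le> m") (auto simp: ennreal_of_nat_eq_real_of_nat)
  have "(\<integral>\<^sup>+\<omega>. ennreal \<bar>S (N \<omega>) \<omega> - S (M \<omega>) \<omega>\<bar> \<partial>P)
      \<le> (\<integral>\<^sup>+\<omega>. (\<Sum>i. indicator (?A i) \<omega> * ennreal (X (Suc i) \<omega>)) \<partial>P)"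
  proof (rule nn_integral_mono_AE)
    show "AE \<omega> in P. ennreal \<bar>S (N \<omega>) \<omega> - S (M \<omega>) \<omega>\<bar> \<le> (\<Sum>i. indicator (?A i) \<omega> * ennreal (X (Suc i) \<omega>))"
      using AE_X_nonneg AE_space[of P]
    proof eventually_elim
      case (elim \<omega>)
      then show ?case
        using abs_S_diff_le[of \<omega> "N \<omega>" "M \<omega>"]
        by (simp add: ind[OF elim(2)] sum_ennreal ennreal_leI)
    qed
  qed
  also have "\<dots> = (\<Sum>i. emeasure P (?A i) * ennreal (mu (Suc i)))"
    by (subst nn_integral_random_index[of "\<lambda>i \<omega>. ennreal (X (Suc i) \<omega>)" "\<lambda>i n m. min n m \<le> i \<and> i < max n m"])
      (simp_all only: nn_integral_X, measurable)
  also have "\<dots> \<le> (\<Sum>i. (SUP i\<in>{1..}. ennreal (mu i)) * emeasure P (?A i))"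
  proof (rule suminf_le)
    show "emeasure P (?A i) * ennreal (mu (Suc i)) \<le> (SUP i\<in>{1..}. ennreal (mu i)) * emeasure P (?A i)" for i
      by (subst mult.commute) (intro mult_right_mono SUP_upper, auto)
  qed auto
  \<comment> \<open>The integral of 1 is inserted so that \<open>nn_integral_random_index\<close>
    can be read backwards with g = 1, which counts the indices.\<close>
  also have "\<dots> = (SUP i\<in>{1..}. ennreal (mu i)) * (\<Sum>i. emeasure P (?A i) * (\<integral>\<^sup>+\<omega>. 1 \<partial>P))"
    by (simp add: emeasure_space_1)
  also have "(\<Sum>i. emeasure P (?A i) * (\<integral>\<^sup>+\<omega>. 1 \<partial>P)) = (\<integral>\<^sup>+\<omega>. (\<Sum>i. indicator (?A i) \<omega> * 1) \<partial>P)"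
    by (rule nn_integral_random_index[of "\<lambda>_ _. 1" "\<lambda>i n m. min n m \<le> i \<and> i < max n m", symmetric]) simp
  also have "\<dots> = (\<integral>\<^sup>+\<omega>. ennreal \<bar>real (N \<omega>) - real (M \<omega>)\<bar> \<partial>P)"
    unfolding card by (rule nn_integral_cong) (rule ind)
  finally show ?thesis .
qed

lemma AE_S_M: "AE \<omega> in P. S (M \<omega>) \<omega> = S (Suc (M \<omega> - 1)) \<omega>"
  using AE_M_pos by eventually_elim simp

lemma wasserstein_bound:
  "wasserstein_dist (distr P borel W) exp1
    \<le> ennreal (2 * inverse \<mu>) *
       ((\<integral>\<^sup>+\<omega>. ennreal \<bar>X (M \<omega>) \<omega> - Xe (M \<omega>) \<omega>\<bar> \<partial>P)
        + (SUP i\<in>{1..}. ennreal (mu i)) * (\<integral>\<^sup>+\<omega>. ennreal \<bar>real (N \<omega>) - real (M \<omega>)\<bar> \<partial>P))"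
proof -
  \<comment> \<open>\<open>X 0\<close> and \<open>Xe 0\<close> are arbitrary, so the expression with
    \<open>M\<close> itself is known to be measurable only up to its values on M = 0. The index Suc
    (M - 1) is used until the last change on a null set.\<close>
  have [measurable]: "(\<lambda>\<omega>. X (Suc (M \<omega> - 1)) \<omega> - Xe (Suc (M \<omega> - 1)) \<omega>) \<in> borel_measurable P"
    by (rule measurable_compose_countable[of "\<lambda>m \<omega>. X (Suc m) \<omega> - Xe (Suc m) \<omega>" P borel "\<lambda>\<omega>. M \<omega> - 1"])
      measurable
  have "wasserstein_dist (distr P borel W) exp1 \<le> 2 * (\<integral>\<^sup>+\<omega>. ennreal \<bar>W \<omega> - We \<omega>\<bar> \<partial>P)"
    by (rule wasserstein_exp1_le[OF integrable_W We_measurable We_equilibrium])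
  also have "(\<integral>\<^sup>+\<omega>. ennreal \<bar>W \<omega> - We \<omega>\<bar> \<partial>P)
      \<le> (\<integral>\<^sup>+\<omega>. ennreal (inverse \<mu>) * (ennreal \<bar>X (Suc (M \<omega> - 1)) \<omega> - Xe (Suc (M \<omega> - 1)) \<omega>\<bar>
          + ennreal \<bar>S (N \<omega>) \<omega> - S (M \<omega>) \<omega>\<bar>) \<partial>P)"
  proof (rule nn_integral_mono_AE)
    show "AE \<omega> in P. ennreal \<bar>W \<omega> - We \<omega>\<bar>
        \<le> ennreal (inverse \<mu>) * (ennreal \<bar>X (Suc (M \<omega> - 1)) \<omega> - Xe (Suc (M \<omega> - 1)) \<omega>\<bar>
          + ennreal \<bar>S (N \<omega>) \<omega> - S (M \<omega>) \<omega>\<bar>)"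
      using AE_S_M
    proof eventually_elim
      case (elim \<omega>)
      let ?m = "M \<omega> - 1"
      have "\<bar>W \<omega> - We \<omega>\<bar> = inverse \<mu> * \<bar>S (N \<omega>) \<omega> - T ?m \<omega>\<bar>"
        using mu_pos unfolding W_def We_def right_diff_distrib[symmetric] by (simp add: abs_mult)
      also have "\<dots> \<le> inverse \<mu> * (\<bar>X (Suc ?m) \<omega> - Xe (Suc ?m) \<omega>\<bar> + \<bar>S (N \<omega>) \<omega> - S (M \<omega>) \<omega>\<bar>)"
      proof (rule mult_left_mono)
        have "S (M \<omega>) \<omega> = S ?m \<omega> + X (Suc ?m) \<omega>"
          unfolding elim by (simp add: S_def)
        then show "\<bar>S (N \<omega>) \<omega> - T ?m \<omega>\<bar>
            \<le> \<bar>X (Suc ?m) \<omega> - Xe (Suc ?m) \<omega>\<bar> + \<bar>S (N \<omega>) \<omega> - S (M \<omega>) \<omega>\<bar>"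
          unfolding T_def by linarith
      qed (use mu_pos in simp)
      finally show ?case
        using mu_pos by (simp flip: ennreal_plus ennreal_mult' add: ennreal_leI)
    qed
  qed
  also have "\<dots> = ennreal (inverse \<mu>) * ((\<integral>\<^sup>+\<omega>. ennreal \<bar>X (Suc (M \<omega> - 1)) \<omega> - Xe (Suc (M \<omega> - 1)) \<omega>\<bar> \<partial>P)
      + (\<integral>\<^sup>+\<omega>. ennreal \<bar>S (N \<omega>) \<omega> - S (M \<omega>) \<omega>\<bar> \<partial>P))"
    by (subst nn_integral_cmult, measurable, subst nn_integral_add) measurable
  also have "(\<integral>\<^sup>+\<omega>. ennreal \<bar>X (Suc (M \<omega> - 1)) \<omega> - Xe (Suc (M \<omega> - 1)) \<omega>\<bar> \<partial>P)
      = (\<integral>\<^sup>+\<omega>. ennreal \<bar>X (M \<omega>) \<omega> - Xe (M \<omega>) \<omega>\<bar> \<partial>P)"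
    by (rule nn_integral_cong_AE, use AE_M_pos in eventually_elim) simp
  also have "2 * (ennreal (inverse \<mu>) * (\<dots> + (\<integral>\<^sup>+\<omega>. ennreal \<bar>S (N \<omega>) \<omega> - S (M \<omega>) \<omega>\<bar> \<partial>P)))
      = ennreal (2 * inverse \<mu>) * (\<dots> + (\<integral>\<^sup>+\<omega>. ennreal \<bar>S (N \<omega>) \<omega> - S (M \<omega>) \<omega>\<bar> \<partial>P))"
    using mu_pos by (simp add: ennreal_mult' mult.assoc)
  also note nn_integral_S_diff
  finally show ?thesis
    by (simp only: mult_left_mono add_left_mono zero_le)
qed

section \<open>Kolmogorov bound for the random sum\<close>

text \<open>By independence, the tails of \<open>S M\<close> and \<open>T (M - 1)\<close> are
  mixtures with the same weights P(M = i + 1), so they may be compared term by term. In each term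
  \<open>S i\<close> belongs to the past, and the quantile bound compares the conditional laws of
  \<open>X (Suc i)\<close> and \<open>Xe (Suc i)\<close>.\<close>

lemma tail_S_T_le:
  assumes q: "0 \<le> q"
    and bound: "\<And>i. AE \<omega> in P. quantile_sup_dist (\<kappa> (Suc i) \<omega>) (\<kappa>e (Suc i) \<omega>) \<le> ennreal q"
  shows "prob {\<omega> \<in> space P. x + q < S (M \<omega>) \<omega>} \<le> prob {\<omega> \<in> space P. x < T (M \<omega> - 1) \<omega>}"
    and "prob {\<omega> \<in> space P. x + q < T (M \<omega> - 1) \<omega>} \<le> prob {\<omega> \<in> space P. x < S (M \<omega>) \<omega>}"
proof -
  have emeas: "emeasure P {\<omega> \<in> space P. z < Y \<omega>} = (\<integral>\<^sup>+\<omega>. indicator {z<..} (Y \<omega>) \<partial>P)"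
    if [measurable]: "Y \<in> borel_measurable P" for Y :: "'a \<Rightarrow> real" and z
  proof -
    have "(\<integral>\<^sup>+\<omega>. indicator {z<..} (Y \<omega>) \<partial>P) = (\<integral>\<^sup>+\<omega>. indicator {\<omega> \<in> space P. z < Y \<omega>} \<omega> \<partial>P)"
      by (rule nn_integral_cong) (auto split: split_indicator)
    then show ?thesis by simp
  qed
  have S_at_M: "emeasure P {\<omega> \<in> space P. z < S (M \<omega>) \<omega>}
      = (\<Sum>i. emeasure P {\<omega> \<in> space P. M \<omega> = Suc i} * (\<integral>\<^sup>+\<omega>. indicator {z<..} (S (Suc i) \<omega>) \<partial>P))" for z
  proof -
    have "emeasure P {\<omega> \<in> space P. z < S (M \<omega>) \<omega>} = (\<integral>\<^sup>+\<omega>. indicator {z<..} (S (Suc (M \<omega> - 1)) \<omega>) \<partial>P)"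
      unfolding emeas[OF S_M_measurable]
      by (rule nn_integral_cong_AE, use AE_S_M in eventually_elim) simp
    also have "\<dots> = (\<Sum>i. emeasure P {\<omega> \<in> space P. M \<omega> = Suc i} * (\<integral>\<^sup>+\<omega>. indicator {z<..} (S (Suc i) \<omega>) \<partial>P))"
      by (rule nn_integral_at_M) measurable
    finally show ?thesis .
  qed
  have T_at_M: "emeasure P {\<omega> \<in> space P. z < T (M \<omega> - 1) \<omega>}
      = (\<Sum>i. emeasure P {\<omega> \<in> space P. M \<omega> = Suc i} * (\<integral>\<^sup>+\<omega>. indicator {z<..} (T i \<omega>) \<partial>P))" for z
    unfolding emeas[OF T_M_measurable] by (rule nn_integral_at_M) measurable
  have S_Suc: "S (Suc i) \<omega> = S i \<omega> + X (Suc i) \<omega>" for i \<omega> by (simp add: S_def)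
  have 1: "(\<integral>\<^sup>+\<omega>. indicator {x + q<..} (S (Suc i) \<omega>) \<partial>P) \<le> (\<integral>\<^sup>+\<omega>. indicator {x<..} (T i \<omega>) \<partial>P)" for i
    unfolding S_Suc T_def
  proof (rule regular_cond_law_tail_mono[OF subalgebra_past X_measurable Xe_measurable \<kappa>_law \<kappa>e_law S_measurable_past])
    show "AE \<omega> in P. \<forall>x. measure (\<kappa> (Suc i) \<omega>) {x + q<..} \<le> measure (\<kappa>e (Suc i) \<omega>) {x<..}"
      using bound[of i] AE_space[of P]
      by eventually_elim (intro allI measure_greaterThan_le_of_quantile_sup_dist
          real_distribution_\<kappa> real_distribution_\<kappa>e q)
  qed
  have 2: "(\<integral>\<^sup>+\<omega>. indicator {x + q<..} (T i \<omega>) \<partial>P) \<le> (\<integral>\<^sup>+\<omega>. indicator {x<..} (S (Suc i) \<omega>) \<partial>P)" for i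
    unfolding S_Suc T_def
  proof (rule regular_cond_law_tail_mono[OF subalgebra_past Xe_measurable X_measurable \<kappa>e_law \<kappa>_law S_measurable_past])
    show "AE \<omega> in P. \<forall>x. measure (\<kappa>e (Suc i) \<omega>) {x + q<..} \<le> measure (\<kappa> (Suc i) \<omega>) {x<..}"
      using bound[of i] AE_space[of P] unfolding quantile_sup_dist_commute[of "\<kappa> (Suc i) _"]
      by eventually_elim (intro allI measure_greaterThan_le_of_quantile_sup_dist
          real_distribution_\<kappa> real_distribution_\<kappa>e q)
  qed
  have "emeasure P {\<omega> \<in> space P. x + q < S (M \<omega>) \<omega>} \<le> emeasure P {\<omega> \<in> space P. x < T (M \<omega> - 1) \<omega>}"
    unfolding S_at_M T_at_M by (intro suminf_le mult_left_mono 1) auto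
  then show "prob {\<omega> \<in> space P. x + q < S (M \<omega>) \<omega>} \<le> prob {\<omega> \<in> space P. x < T (M \<omega> - 1) \<omega>}"
    by (simp add: emeasure_eq_measure)
  have "emeasure P {\<omega> \<in> space P. x + q < T (M \<omega> - 1) \<omega>} \<le> emeasure P {\<omega> \<in> space P. x < S (M \<omega>) \<omega>}"
    unfolding S_at_M T_at_M by (intro suminf_le mult_left_mono 2) auto
  then show "prob {\<omega> \<in> space P. x + q < T (M \<omega> - 1) \<omega>} \<le> prob {\<omega> \<in> space P. x < S (M \<omega>) \<omega>}"
    by (simp add: emeasure_eq_measure)
qed

text \<open>The free parameter \<open>r\<close> serves both final cases: \<open>C * K\<close> for
  bounded summands and 0 when N = M almost surely.\<close>

lemma kolmogorov_bound:
  assumes r: "0 \<le> r" and close: "AE \<omega> in P. \<bar>S (N \<omega>) \<omega> - S (M \<omega>) \<omega>\<bar> \<le> r"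
  shows "kolmogorov_dist (distr P borel W) exp1
    \<le> ennreal (12 * inverse \<mu>) *
       ((SUP i\<in>{1..}. esssup P (\<lambda>\<omega>. quantile_sup_dist (\<kappa> i \<omega>) (\<kappa>e i \<omega>))) + ennreal r)"
proof (cases "(SUP i\<in>{1..}. esssup P (\<lambda>\<omega>. quantile_sup_dist (\<kappa> i \<omega>) (\<kappa>e i \<omega>)))")
  case top
  show ?thesis unfolding top using mu_pos by (simp add: ennreal_mult_top)
next
  case (real q)
  have bound: "AE \<omega> in P. quantile_sup_dist (\<kappa> (Suc i) \<omega>) (\<kappa>e (Suc i) \<omega>) \<le> ennreal q" for i
  proof -
    have "esssup P (\<lambda>\<omega>. quantile_sup_dist (\<kappa> (Suc i) \<omega>) (\<kappa>e (Suc i) \<omega>)) \<le> ennreal q"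
      unfolding real(2)[symmetric] by (rule SUP_upper) simp
    then show ?thesis
      using esssup_AE[of "\<lambda>\<omega>. quantile_sup_dist (\<kappa> (Suc i) \<omega>) (\<kappa>e (Suc i) \<omega>)" P]
      by (auto elim!: eventually_mono)
  qed
  note tail = tail_S_T_le[OF real(1) bound]
  \<comment> \<open>The shift q separates \<open>T (M - 1)\<close> from \<open>S M\<close> in
    distribution, r separates \<open>S M\<close> from \<open>S N\<close> pathwise, and dividing by
    \<mu> rescales to \<open>W\<close> and \<open>We\<close>.\<close>
  define b where "b = inverse \<mu> * (q + r)"
  have b: "0 \<le> b" using real(1) r mu_pos by (simp add: b_def)
  have W_iff: "x < W \<omega> \<longleftrightarrow> \<mu> * x < S (N \<omega>) \<omega>" and We_iff: "x < We \<omega> \<longleftrightarrow> \<mu> * x < T (M \<omega> - 1) \<omega>" for x \<omega>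
    using mu_pos by (simp_all add: W_def We_def field_simps)
  \<comment> \<open>Both orders occur: a tail of \<open>W\<close> first gives up r to reach
    \<open>S M\<close> and then q, a tail of \<open>We\<close> first gives up q and then r.\<close>
  have shift: "\<mu> * (x + b) = (\<mu> * x + r) + q" "\<mu> * (x + b) = (\<mu> * x + q) + r" for x
    using mu_pos by (simp_all add: b_def field_simps)
  have "kolmogorov_dist (distr P borel W) exp1 \<le> ennreal (2 * b)"
  proof (rule kolmogorov_exp1_le[OF integrable_W AE_W_nonneg expectation_W We_measurable We_equilibrium b])
    fix x
    have "prob {\<omega> \<in> space P. x + b < W \<omega>} \<le> prob {\<omega> \<in> space P. \<mu> * x + q < S (M \<omega>) \<omega>}"
      unfolding W_iff shift(2)
    proof (rule finite_measure_mono_AE)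
      show "AE \<omega> in P. \<omega> \<in> {\<omega> \<in> space P. \<mu> * x + q + r < S (N \<omega>) \<omega>}
          \<longrightarrow> \<omega> \<in> {\<omega> \<in> space P. \<mu> * x + q < S (M \<omega>) \<omega>}"
        using close by eventually_elim auto
    qed measurable
    also have "\<dots> \<le> prob {\<omega> \<in> space P. x < We \<omega>}"
      unfolding We_iff by (rule tail(1))
    finally show "prob {\<omega> \<in> space P. x + b < W \<omega>} \<le> prob {\<omega> \<in> space P. x < We \<omega>}" .
    have "prob {\<omega> \<in> space P. x + b < We \<omega>} \<le> prob {\<omega> \<in> space P. \<mu> * x + r < S (M \<omega>) \<omega>}"
      unfolding We_iff shift(1) by (rule tail(2))
    also have "\<dots> \<le> prob {\<omega> \<in> space P. x < W \<omega>}"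
      unfolding W_iff
    proof (rule finite_measure_mono_AE)
      show "AE \<omega> in P. \<omega> \<in> {\<omega> \<in> space P. \<mu> * x + r < S (M \<omega>) \<omega>}
          \<longrightarrow> \<omega> \<in> {\<omega> \<in> space P. \<mu> * x < S (N \<omega>) \<omega>}"
        using close by eventually_elim auto
    qed measurable
    finally show "prob {\<omega> \<in> space P. x + b < We \<omega>} \<le> prob {\<omega> \<in> space P. x < W \<omega>}" .
  qed
  also have "\<dots> \<le> ennreal (12 * inverse \<mu> * (q + r))"
    using b by (intro ennreal_leI) (simp add: b_def)
  also have "\<dots> = ennreal (12 * inverse \<mu>) * (ennreal q + ennreal r)"
    using mu_pos r real(1) by (simp add: ennreal_mult' ennreal_plus)
  finally show ?thesis unfolding real(2) .
qed

lemma AE_S_diff_le: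
  assumes C: "\<And>i. i \<ge> 1 \<Longrightarrow> AE \<omega> in P. X i \<omega> \<le> C"
    and K: "AE \<omega> in P. \<bar>real (N \<omega>) - real (M \<omega>)\<bar> \<le> K"
  shows "AE \<omega> in P. \<bar>S (N \<omega>) \<omega> - S (M \<omega>) \<omega>\<bar> \<le> C * K"
proof -
  have "AE \<omega> in P. \<forall>i. X (Suc i) \<omega> \<le> C"
    by (rule AE_all_countable[THEN iffD2], intro allI C) simp
  with AE_X_nonneg K show ?thesis
  proof eventually_elim
    case (elim \<omega>)
    let ?n = "N \<omega>" and ?m = "M \<omega>"
    \<comment> \<open>\<open>C\<close> dominates a nonnegative summand, so it is itself
      nonnegative.\<close>
    have C0: "0 \<le> C" using elim(1,3) order_trans by blast
    have "\<bar>S ?n \<omega> - S ?m \<omega>\<bar> \<le> (\<Sum>i = min ?n ?m..<max ?n ?m. X (Suc i) \<omega>)"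
      using elim(1) by (intro abs_S_diff_le) auto
    also have "\<dots> \<le> (\<Sum>i = min ?n ?m..<max ?n ?m. C)"
      using elim(3) by (intro sum_mono) auto
    also have "\<dots> = C * \<bar>real ?n - real ?m\<bar>"
      by (cases "?n \<le> ?m") (auto simp: of_nat_diff)
    also have "\<dots> \<le> C * K" using elim(2) C0 by (rule mult_left_mono)
    finally show ?case .
  qed
qed

end

theorem theorem3p1:
  fixes P :: "'a measure"
    and X Xe :: "nat \<Rightarrow> 'a \<Rightarrow> real"
    and N M :: "'a \<Rightarrow> nat"
    and mu :: "nat \<Rightarrow> real"
    and \<mu> :: real
    and \<kappa> \<kappa>e :: "nat \<Rightarrow> 'a \<Rightarrow> real measure"
    and W :: "'a \<Rightarrow> real"
  assumes "prob_space P"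
    and X_rv: "\<And>i. i \<ge> 1 \<Longrightarrow> X i \<in> borel_measurable P"
    and X_sq: "\<And>i. i \<ge> 1 \<Longrightarrow> integrable P (\<lambda>\<omega>. (X i \<omega>)\<^sup>2)"
    and X_nonneg: "\<And>i. i \<ge> 1 \<Longrightarrow> AE \<omega> in P. 0 \<le> X i \<omega>"
    and X_cond: "\<And>i. i \<ge> 1 \<Longrightarrow> AE \<omega> in P. real_cond_exp P (past P X i) (X i) \<omega> = mu i"
    and N_rv: "N \<in> P \<rightarrow>\<^sub>M count_space UNIV"
    and N_pos: "AE \<omega> in P. 1 \<le> N \<omega>"
    and N_mean: "integrable P (\<lambda>\<omega>. real (N \<omega>))"
    and mu_def: "has_bochner_integral P (\<lambda>\<omega>. \<Sum>i = 1..N \<omega>. X i \<omega>) \<mu>"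
    and mu_pos: "0 < \<mu>"
    and M_rv: "M \<in> P \<rightarrow>\<^sub>M count_space UNIV"
    and M_law: "\<And>m. m \<ge> 1 \<Longrightarrow>
        measure P {\<omega> \<in> space P. M \<omega> = m} = mu m * measure P {\<omega> \<in> space P. N \<omega> \<ge> m} / \<mu>"
    and Xe_rv: "\<And>i. i \<ge> 1 \<Longrightarrow> Xe i \<in> borel_measurable P"
    and X_law: "\<And>i. i \<ge> 1 \<Longrightarrow> regular_cond_law P (past P X i) (X i) (\<kappa> i)"
    and Xe_law: "\<And>i. i \<ge> 1 \<Longrightarrow> regular_cond_law P (past P X i) (Xe i) (\<kappa>e i)"
    and Xe_equilibrium: "\<And>i. i \<ge> 1 \<Longrightarrow> AE \<omega> in P. equilibrium_law (\<kappa> i \<omega>) (\<kappa>e i \<omega>)"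
    and indep: "prob_space.indep_set P
        (sets (vimage_algebra (space P) (\<lambda>\<omega>. \<lambda>i\<in>{1..}. (X i \<omega>, Xe i \<omega>))
          (\<Pi>\<^sub>M i\<in>{1..}. borel \<Otimes>\<^sub>M borel)))
        (sets (vimage_algebra (space P) (\<lambda>\<omega>. (N \<omega>, M \<omega>)) (count_space UNIV)))"
    and W_def: "\<And>\<omega>. W \<omega> = inverse \<mu> * (\<Sum>i = 1..N \<omega>. X i \<omega>)"
  shows "((\<lambda>m. mu (Suc m) * measure P {\<omega> \<in> space P. N \<omega> \<ge> Suc m}) sums \<mu>) \<and>
    wasserstein_dist (distr P borel W) exp1
      \<le> ennreal (2 * inverse \<mu>) *
         ((\<integral>\<^sup>+\<omega>. ennreal \<bar>X (M \<omega>) \<omega> - Xe (M \<omega>) \<omega>\<bar> \<partial>P)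
          + (SUP i\<in>{1..}. ennreal (mu i)) *
            (\<integral>\<^sup>+\<omega>. ennreal \<bar>real (N \<omega>) - real (M \<omega>)\<bar> \<partial>P)) \<and>
    (\<forall>C K :: real.
      (\<forall>i\<ge>1. AE \<omega> in P. X i \<omega> \<le> C) \<longrightarrow>
      (AE \<omega> in P. \<bar>real (N \<omega>) - real (M \<omega>)\<bar> \<le> K) \<longrightarrow>
      kolmogorov_dist (distr P borel W) exp1
      \<le> ennreal (12 * inverse \<mu>) *
         ((SUP i\<in>{1..}. esssup P (\<lambda>\<omega>. quantile_sup_dist (\<kappa> i \<omega>) (\<kappa>e i \<omega>)))
          + ennreal (C * K))) \<and>
    ((AE \<omega> in P. \<bar>real (N \<omega>) - real (M \<omega>)\<bar> \<le> 0) \<longrightarrow>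
      kolmogorov_dist (distr P borel W) exp1
      \<le> ennreal (12 * inverse \<mu>) *
         (SUP i\<in>{1..}. esssup P (\<lambda>\<omega>. quantile_sup_dist (\<kappa> i \<omega>) (\<kappa>e i \<omega>))))"
proof -
  interpret prob_space P by fact
  interpret R: random_sum P X Xe N M mu \<mu> \<kappa> \<kappa>e
    by unfold_locales (fact X_rv X_sq X_nonneg X_cond N_rv mu_def mu_pos M_rv M_law Xe_rv X_law Xe_law
        Xe_equilibrium indep)+
  have W: "W = R.W"
    by (rule ext) (simp only: W_def R.W_def R.sum_eq_S)
  show ?thesis
    unfolding W
  proof (intro conjI allI impI)
    show "(\<lambda>m. mu (Suc m) * prob {\<omega> \<in> space P. N \<omega> \<ge> Suc m}) sums \<mu>"
      by (rule R.mean_sums)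
    show "wasserstein_dist (distr P borel R.W) exp1
      \<le> ennreal (2 * inverse \<mu>) *
         ((\<integral>\<^sup>+\<omega>. ennreal \<bar>X (M \<omega>) \<omega> - Xe (M \<omega>) \<omega>\<bar> \<partial>P)
          + (SUP i\<in>{1..}. ennreal (mu i)) * (\<integral>\<^sup>+\<omega>. ennreal \<bar>real (N \<omega>) - real (M \<omega>)\<bar> \<partial>P))"
      by (rule R.wasserstein_bound)
  next
    fix C K :: real
    assume C: "\<forall>i\<ge>1. AE \<omega> in P. X i \<omega> \<le> C" and K: "AE \<omega> in P. \<bar>real (N \<omega>) - real (M \<omega>)\<bar> \<le> K"
    have close: "AE \<omega> in P. \<bar>R.S (N \<omega>) \<omega> - R.S (M \<omega>) \<omega>\<bar> \<le> C * K"
      using C K by (intro R.AE_S_diff_le) auto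
    \<comment> \<open>\<open>C * K\<close> bounds an absolute value almost surely, and a constant
      statement that holds almost surely under a probability measure is true.\<close>
    then have "AE \<omega> in P. 0 \<le> C * K" by eventually_elim auto
    then have "0 \<le> C * K" by simp
    then show "kolmogorov_dist (distr P borel R.W) exp1
      \<le> ennreal (12 * inverse \<mu>) *
         ((SUP i\<in>{1..}. esssup P (\<lambda>\<omega>. quantile_sup_dist (\<kappa> i \<omega>) (\<kappa>e i \<omega>))) + ennreal (C * K))"
      using close by (rule R.kolmogorov_bound)
  next
    assume "AE \<omega> in P. \<bar>real (N \<omega>) - real (M \<omega>)\<bar> \<le> 0"
    \<comment> \<open>K = 0 means N = M almost surely, so the two partial sums coincide and no bound
      on the summands enters.\<close>
    then have "AE \<omega> in P. \<bar>R.S (N \<omega>) \<omega> - R.S (M \<omega>) \<omega>\<bar> \<le> 0"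
      by eventually_elim simp
    from R.kolmogorov_bound[OF order_refl this]
    show "kolmogorov_dist (distr P borel R.W) exp1
      \<le> ennreal (12 * inverse \<mu>) * (SUP i\<in>{1..}. esssup P (\<lambda>\<omega>. quantile_sup_dist (\<kappa> i \<omega>) (\<kappa>e i \<omega>)))"
      by simp
  qed
qed

end
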